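(* Let $n,m\ge 1$ be integers, let $1<p_1,\ldots,p_m<\infty$, let $p$ be defined by $\frac1p=\frac1{p_1}+\cdots+\frac1{p_m}$, and put $\vec P=(p_1,\ldots,p_m)$. Then there is a constant $C=C_{m,n,\vec P}$, depending only on $m,n,\vec P$, such that for every $\vec w=(w_1,\ldots,w_m)\in A_{\vec P}$ and all $f_i\in L^{p_i}(w_i)$, $i=1,\ldots,m$, $$\|\mathcal M(\vec f)\|_{L^p(v_{\vec w})}\le C\,[\vec w]_{A_{\vec P}}^{\max\left(\frac{p_1'}{p},\ldots,\frac{p_m'}{p}\right)}\prod_{i=1}^m\|f_i\|_{L^{p_i}(w_i)}.$$ Moreover, the exponent on $[\vec w]_{A_{\vec P}}$ is the best possible: for no real $\alpha<\max\left(\frac{p_1'}{p},\ldots,\frac{p_m'}{p}\right)$ does there exist a constant $C$ such that $\|\mathcal M(\vec f)\|_{L^p(v_{\vec w})}\le C[\vec w]_{A_{\vec P}}^{\alpha}\prod_{i=1}^m\|f_i\|_{L^{p_i}(w_i)}$ holds for all $\vec w\in A_{\vec P}$ and all $f_i\in L^{p_i}(w_i)$.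
   Context: All functions are on $\mathbb R^n$; $p_i'=p_i/(p_i-1)$ is the conjugate exponent. Cubes $Q\subset\mathbb R^n$ have sides parallel to the axes, and $|Q|$ is Lebesgue measure. For a non-negative measurable $w$ and $0<q<\infty$, $\|f\|_{L^q(w)}=\left(\int_{\mathbb R^n}|f|^q w\,dx\right)^{1/q}$ (only a quasi-norm when $q<1$). Multiple weights: let $\vec w=(w_1,\ldots,w_m)$, where each $w_i$ is measurable with $0<w_i<\infty$ a.e. Set $v_{\vec w}=\prod_{i=1}^m w_i^{p/p_i}$ and $$[\vec w]_{A_{\vec P}}=\sup_Q\left(\frac1{|Q|}\int_Q v_{\vec w}\right)\prod_{i=1}^m\left(\frac1{|Q|}\int_Q w_i^{1-p_i'}\right)^{p/p_i'},$$ where the supremum is over all cubes $Q\subset\mathbb R^n$. One writes $\vec w\in A_{\vec P}$ if $[\vec w]_{A_{\vec P}}<\infty$. Multilinear maximal function: for $\vec f=(f_1,\ldots,f_m)$, $$\mathcal M(\vec f)(x)=\sup_{Q\ni x}\prod_{i=1}^m\frac1{|Q|}\int_Q|f_i|,$$ where the supremum is over all cubes $Q$ containing $x$. *)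

theory Defs
  imports "HOL-Analysis.Analysis"
begin

text \<open>Real powers on \<^typ>\<open>ennreal\<close>, with \<open>0\<^sup>a = \<infinity>\<close>, \<open>\<infinity>\<^sup>a = 0\<close> for \<open>a < 0\<close>
  and \<open>x\<^sup>0 = 1\<close>. The case distinction is needed because \<open>0 powr a = 0\<close> for every real \<open>a\<close>.\<close>

definition ennpow :: "ennreal \<Rightarrow> real \<Rightarrow> ennreal" where
  "ennpow x a =
     (if a = 0 then 1
      else if x = 0 then (if a > 0 then 0 else \<infinity>)
      else if x = \<infinity> then (if a > 0 then \<infinity> else 0)
      else ennreal (enn2real x powr a))"

definition conj_exp :: "real \<Rightarrow> real" where
  "conj_exp q = q / (q - 1)"

text \<open>Closed, non-degenerate cubes with sides parallel to the axes.\<close>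

definition cubes :: "(real ^ 'n) set set" where
  "cubes = {cbox a b | a b. \<exists>l>0. \<forall>i. b $ i - a $ i = l}"

definition average :: "(real ^ 'n) set \<Rightarrow> (real ^ 'n \<Rightarrow> ennreal) \<Rightarrow> ennreal" where
  "average Q g = (\<integral>\<^sup>+x\<in>Q. g x \<partial>lebesgue) / emeasure lebesgue Q"

text \<open>The weighted (quasi-)norm of a non-negative, possibly infinite-valued function; a signed
  function \<open>f\<close> enters as \<open>\<bar>f\<bar>\<close>. Weights are real-valued: only their values up to null sets
  matter, so an almost everywhere finite weight loses nothing by this.\<close>

definition wnorm :: "real \<Rightarrow> (real ^ 'n \<Rightarrow> real) \<Rightarrow> (real ^ 'n \<Rightarrow> ennreal) \<Rightarrow> ennreal" where
  "wnorm q w g = ennpow (\<integral>\<^sup>+x. ennpow (g x) q * ennreal (w x) \<partial>lebesgue) (1 / q)"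

abbreviation Lnorm :: "real \<Rightarrow> (real ^ 'n \<Rightarrow> real) \<Rightarrow> (real ^ 'n \<Rightarrow> real) \<Rightarrow> ennreal" where
  "Lnorm q w f \<equiv> wnorm q w (\<lambda>x. ennreal \<bar>f x\<bar>)"

definition Lspace :: "real \<Rightarrow> (real ^ 'n \<Rightarrow> real) \<Rightarrow> (real ^ 'n \<Rightarrow> real) set" where
  "Lspace q w = {f \<in> borel_measurable lebesgue. Lnorm q w f < \<infinity>}"

definition weight :: "(real ^ 'n \<Rightarrow> real) \<Rightarrow> bool" where
  "weight w \<longleftrightarrow> w \<in> borel_measurable lebesgue \<and> (AE x in lebesgue. 0 < w x)"

text \<open>An \<open>m\<close>-tuple is a function on \<^typ>\<open>nat\<close> of which only the values at indices \<open>i < m\<close> are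
  used. Below, \<open>P i\<close> are the exponents \<open>p\<^sub>i\<close>, and \<open>p\<close> is the exponent determined
  by \<open>1/p = (\<Sum>i<m. 1 / P i)\<close>.\<close>

definition joint_exp :: "nat \<Rightarrow> (nat \<Rightarrow> real) \<Rightarrow> real" where
  "joint_exp m P = 1 / (\<Sum>i<m. 1 / P i)"

definition joint_weight ::
    "nat \<Rightarrow> (nat \<Rightarrow> real) \<Rightarrow> (nat \<Rightarrow> real ^ 'n \<Rightarrow> real) \<Rightarrow> real ^ 'n \<Rightarrow> real" where
  "joint_weight m P w x = (\<Prod>i<m. w i x powr (joint_exp m P / P i))"

definition AP_const :: "nat \<Rightarrow> (nat \<Rightarrow> real) \<Rightarrow> (nat \<Rightarrow> real ^ 'n \<Rightarrow> real) \<Rightarrow> ennreal" where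
  "AP_const m P w =
     (SUP Q \<in> cubes. average Q (\<lambda>x. ennreal (joint_weight m P w x)) *
        (\<Prod>i<m. ennpow (average Q (\<lambda>x. ennreal (w i x powr (1 - conj_exp (P i)))))
                       (joint_exp m P / conj_exp (P i))))"

definition AP :: "nat \<Rightarrow> (nat \<Rightarrow> real) \<Rightarrow> (nat \<Rightarrow> real ^ 'n \<Rightarrow> real) set" where
  "AP m P = {w. (\<forall>i<m. weight (w i)) \<and> AP_const m P w < \<infinity>}"

definition multi_maximal ::
    "nat \<Rightarrow> (nat \<Rightarrow> real ^ 'n \<Rightarrow> real) \<Rightarrow> real ^ 'n \<Rightarrow> ennreal" where
  "multi_maximal m f x = (SUP Q \<in> {Q \<in> cubes. x \<in> Q}. \<Prod>i<m. average Q (\<lambda>y. ennreal \<bar>f i y\<bar>))"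

end

theory Submission
  imports Defs
begin

text \<open>
  Upper bound. Let \<open>\<sigma>\<^sub>i\<close> be the dual weights, the powers \<open>1 - p\<^sub>i'\<close> of the \<open>w\<^sub>i\<close>. The proof
  dominates the multilinear maximal function pointwise by linear maximal functions with respect to
  the weights themselves: on dyadic cubes, with \<open>\<beta>\<close> the maximum of the \<open>p\<^sub>i' / p\<close>, it is at most
  the power \<open>\<beta>\<close> of \<open>[w] M\<^sub>v h\<close>, where \<open>M\<^sub>v\<close> is the dyadic maximal operator of the measure \<open>v dx\<close>,
  and \<open>h\<close> is the product of the powers \<open>1 / \<beta>\<close> of \<open>M\<^bsub>\<sigma>\<^sub>i\<^esub> (f\<^sub>i / \<sigma>\<^sub>i)\<close> and of suitable negative
  powers of the weights (\<open>grid_product_le\<close>). The whole dependence on the weight constant is the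
  power \<open>\<beta>\<close> visible there, because dyadic maximal operators are bounded on \<open>L\<^sup>q\<close> of any measure
  whatsoever, with a constant depending on \<open>q\<close> only (\<open>maximal_strong_type\<close>). Applying this to
  \<open>M\<^sub>v\<close> on the exponent \<open>\<beta> p > 1\<close>, then Hoelder's inequality with exponents \<open>p\<^sub>i / p\<close>, for which
  the powers of the weights balance exactly, then the boundedness of the \<open>M\<^bsub>\<sigma>\<^sub>i\<^esub>\<close> on the exponents
  \<open>p\<^sub>i\<close>, gives the norm inequality on a dyadic grid (\<open>grid_product_bound\<close>).

  Every cube is contained in a cell of comparable size of one of \<open>2\<^sup>n\<close> translates of a dyadic
  grid, by the one-third trick (\<open>cube_subset_grid_cell\<close>). The translates depend on an upper bound
  \<open>2\<^sup>K\<close> for the scales, and \<open>K\<close> is sent to infinity with Fatou's lemma (\<open>multi_maximal_bound\<close>).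

  Sharpness. Take \<open>i0\<close> with maximal \<open>p\<^sub>i'\<close>, let \<open>\<sigma>\<^bsub>i0\<^esub>\<close> be \<open>\<bar>x\<^sub>k\<bar>\<close> to the power \<open>e - 1\<close> for one
  coordinate \<open>k\<close>, and take the other weights to be \<open>1\<close>. Then the weight constant is at most
  \<open>2 / e\<close> to the power \<open>p / p\<^bsub>i0\<^esub>'\<close>, while for suitable power functions the ratio of the two norms
  is at least \<open>1 / e\<close> (\<open>exponent_sharp\<close>). Letting \<open>e\<close> tend to \<open>0\<close> excludes every exponent below
  \<open>p\<^bsub>i0\<^esub>' / p\<close>.
\<close>

section \<open>Powers of extended nonnegative reals\<close>

lemma ennpow_0_exp [simp]: "ennpow x 0 = 1"
  by (simp add: ennpow_def)

lemma ennpow_zero [simp]: "a > 0 \<Longrightarrow> ennpow 0 a = 0"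
  by (simp add: ennpow_def)

lemma ennpow_top [simp]: "a > 0 \<Longrightarrow> ennpow top a = top"
  by (simp add: ennpow_def)

lemma ennpow_one [simp]: "ennpow 1 a = 1"
  by (simp add: ennpow_def)

lemma ennpow_pos: "0 < x \<Longrightarrow> ennpow (ennreal x) a = ennreal (x powr a)"
  by (auto simp: ennpow_def)

lemma ennpow_nonneg: "0 \<le> x \<Longrightarrow> 0 < a \<Longrightarrow> ennpow (ennreal x) a = ennreal (x powr a)"
  by (auto simp: ennpow_def)

lemma ennpow_exp_1 [simp]: "ennpow x 1 = x"
  by (auto simp: ennpow_def less_top)

lemma ennpow_mult:
  assumes "a \<ge> 0"
  shows "ennpow (x * y) a = ennpow x a * ennpow y a"
proof (cases "a = 0")
  case False
  with assms have a: "a > 0" by simp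
  show ?thesis
    using a by (cases x; cases y)
      (auto simp: ennpow_def ennreal_mult_eq_top_iff ennreal_mult[symmetric] powr_mult
        ennreal_top_mult ennreal_mult_top)
qed simp

lemma ennpow_prod:
  assumes "a \<ge> 0"
  shows "ennpow (\<Prod>i\<in>I. x i) a = (\<Prod>i\<in>I. ennpow (x i) a)"
  by (induction I rule: infinite_finite_induct) (simp_all add: ennpow_mult assms)

lemma ennpow_add:
  assumes "a \<ge> 0" "b \<ge> 0"
  shows "ennpow x (a + b) = ennpow x a * ennpow x b"
proof -
  consider "a = 0" | "b = 0" | "a > 0" "b > 0" using assms by linarith
  then show ?thesis
    by cases (auto simp: ennpow_def powr_add ennreal_mult)
qed

lemma ennpow_ennpow:
  assumes "a \<ge> 0" "b \<ge> 0"
  shows "ennpow (ennpow x a) b = ennpow x (a * b)"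
proof -
  consider "a = 0" | "b = 0" | "a > 0" "b > 0" using assms by linarith
  then show ?thesis
    by cases (auto simp: ennpow_def powr_powr)
qed

lemma ennpow_mono:
  assumes "a \<ge> 0" "x \<le> y"
  shows "ennpow x a \<le> ennpow y a"
proof (cases "a = 0")
  case False
  with assms have a: "a > 0" by simp
  show ?thesis
    using a assms(2)
    by (cases x; cases y) (auto simp: ennpow_nonneg intro!: ennreal_leI powr_mono2 simp: top_unique)
qed simp

lemma ennpow_le_iff:
  assumes "a > 0"
  shows "ennpow x a \<le> y \<longleftrightarrow> x \<le> ennpow y (1 / a)"
proof
  assume "ennpow x a \<le> y"
  from ennpow_mono[OF _ this, of "1/a"] show "x \<le> ennpow y (1/a)"
    using assms by (simp add: ennpow_ennpow)
next
  assume "x \<le> ennpow y (1/a)"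
  from ennpow_mono[OF _ this, of a] show "ennpow x a \<le> y"
    using assms by (simp add: ennpow_ennpow)
qed

lemma ennpow_eq_0_iff: "a > 0 \<Longrightarrow> ennpow x a = 0 \<longleftrightarrow> x = 0"
  by (auto simp: ennpow_def enn2real_eq_0_iff)

lemma ennpow_eq_top_iff: "a > 0 \<Longrightarrow> ennpow x a = top \<longleftrightarrow> x = top"
  by (auto simp: ennpow_def)

lemma measurable_ennpow [measurable (raw)]:
  assumes [measurable]: "f \<in> borel_measurable M"
  shows "(\<lambda>x. ennpow (f x) a) \<in> borel_measurable M"
  unfolding ennpow_def by measurable

lemma ennpow_SUP_le:
  assumes "a > 0" "\<And>i. i \<in> I \<Longrightarrow> ennpow (f i) a \<le> c"
  shows "ennpow (SUP i\<in>I. f i) a \<le> c"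
  using assms by (auto simp: ennpow_le_iff intro!: SUP_least)

section \<open>Hoelder's inequality\<close>

lemma prod_powr_le_weighted_sum:
  fixes x \<theta> :: "'i \<Rightarrow> real"
  assumes "finite I" and \<theta>: "\<And>i. i \<in> I \<Longrightarrow> \<theta> i > 0" "(\<Sum>i\<in>I. \<theta> i) = 1"
    and x: "\<And>i. i \<in> I \<Longrightarrow> x i \<ge> 0"
  shows "(\<Prod>i\<in>I. x i powr \<theta> i) \<le> (\<Sum>i\<in>I. \<theta> i * x i)"
proof (cases "\<exists>i\<in>I. x i = 0")
  case True
  then have "(\<Prod>i\<in>I. x i powr \<theta> i) = 0" using assms(1) by auto
  also have "0 \<le> (\<Sum>i\<in>I. \<theta> i * x i)" using \<theta> x by (intro sum_nonneg) (simp add: less_imp_le)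
  finally show ?thesis .
next
  case False
  have "I \<noteq> {}" using \<theta>(2) by auto
  have "(\<Prod>i\<in>I. x i powr \<theta> i) = exp (\<Sum>i\<in>I. \<theta> i *\<^sub>R ln (x i))"
    using False assms(1) by (simp add: powr_def exp_sum)
  also have "\<dots> \<le> (\<Sum>i\<in>I. \<theta> i * exp (ln (x i)))"
    using \<theta> \<open>finite I\<close> \<open>I \<noteq> {}\<close> by (intro convex_on_sum[OF _ _ exp_convex]) (auto simp: less_imp_le)
  also have "\<dots> = (\<Sum>i\<in>I. \<theta> i * x i)"
    using False x by (intro sum.cong) (auto simp: less_le)
  finally show ?thesis .
qed

text \<open>The weighted inequality between geometric and arithmetic means carries over to infinite
  entries because all exponents are strictly positive: an infinite entry makes the sum infinite.\<close>

lemma prod_ennpow_le_weighted_sum: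
  fixes x :: "'i \<Rightarrow> ennreal"
  assumes "finite I" and \<theta>: "\<And>i. i \<in> I \<Longrightarrow> \<theta> i > 0" "(\<Sum>i\<in>I. \<theta> i) = 1"
  shows "(\<Prod>i\<in>I. ennpow (x i) (\<theta> i)) \<le> (\<Sum>i\<in>I. ennreal (\<theta> i) * x i)"
proof (cases "\<exists>i\<in>I. x i = top")
  case True
  then obtain j where j: "j \<in> I" "x j = top" by blast
  then have "ennreal (\<theta> j) * x j = top"
    using \<theta>(1)[of j] by (simp add: ennreal_mult_eq_top_iff)
  then have "(\<Sum>i\<in>I. ennreal (\<theta> i) * x i) = top"
    using j assms(1) by (subst ennreal_sum_eq_top) metis+
  then show ?thesis by simp
next
  case False
  define y where "y i = enn2real (x i)" for i
  have xy: "x i = ennreal (y i)" "y i \<ge> 0" if "i \<in> I" for i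
    using that False by (auto simp: y_def less_top)
  have "(\<Prod>i\<in>I. ennpow (x i) (\<theta> i)) = (\<Prod>i\<in>I. ennreal (y i powr \<theta> i))"
    using xy \<theta> by (intro prod.cong) (auto simp: ennpow_nonneg)
  also have "\<dots> = ennreal (\<Prod>i\<in>I. y i powr \<theta> i)" by (simp add: prod_ennreal)
  also have "\<dots> \<le> ennreal (\<Sum>i\<in>I. \<theta> i * y i)"
    using assms xy by (intro ennreal_leI prod_powr_le_weighted_sum) auto
  also have "\<dots> = (\<Sum>i\<in>I. ennreal (\<theta> i * y i))"
    using \<theta> xy by (intro sum_ennreal[symmetric]) (auto simp: less_imp_le)
  also have "\<dots> = (\<Sum>i\<in>I. ennreal (\<theta> i) * x i)"
    using \<theta> xy by (intro sum.cong) (auto simp: ennreal_mult less_imp_le)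
  finally show ?thesis .
qed

lemma nn_integral_prod_ennpow_le_pos:
  fixes g :: "'i \<Rightarrow> 'a \<Rightarrow> ennreal"
  assumes fin: "finite I" and \<theta>: "\<And>i. i \<in> I \<Longrightarrow> \<theta> i > 0" "(\<Sum>i\<in>I. \<theta> i) = 1"
    and [measurable]: "\<And>i. i \<in> I \<Longrightarrow> g i \<in> borel_measurable M"
  shows "(\<integral>\<^sup>+x. (\<Prod>i\<in>I. ennpow (g i x) (\<theta> i)) \<partial>M) \<le> (\<Prod>i\<in>I. ennpow (\<integral>\<^sup>+x. g i x \<partial>M) (\<theta> i))"
proof -
  define G where "G i = (\<integral>\<^sup>+x. g i x \<partial>M)" for i
  consider (zero) j where "j \<in> I" "G j = 0" | (top) j where "j \<in> I" "G j = top" "\<forall>i\<in>I. G i \<noteq> 0"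
    | (fin) "\<forall>i\<in>I. G i \<noteq> 0 \<and> G i \<noteq> top" by blast
  then have "(\<integral>\<^sup>+x. (\<Prod>i\<in>I. ennpow (g i x) (\<theta> i)) \<partial>M) \<le> (\<Prod>i\<in>I. ennpow (G i) (\<theta> i))"
  proof cases
    case zero
    then have "AE x in M. g j x = 0" by (simp add: G_def nn_integral_0_iff_AE)
    then have "AE x in M. (\<Prod>i\<in>I. ennpow (g i x) (\<theta> i)) = 0"
      by eventually_elim (use zero \<theta> fin in \<open>auto simp: ennpow_eq_0_iff\<close>)
    then have "(\<integral>\<^sup>+x. (\<Prod>i\<in>I. ennpow (g i x) (\<theta> i)) \<partial>M) = 0"
      by (simp add: nn_integral_0_iff_AE)
    then show ?thesis by simp
  next
    case top
    have "(\<Prod>i\<in>I. ennpow (G i) (\<theta> i)) = top"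
      using top \<theta> fin
          by (auto simp: ennreal_prod_eq_top ennpow_eq_0_iff ennpow_eq_top_iff intro!: bexI[of _ j])
    then show ?thesis by simp
  next
    case fin
    \<comment> \<open>After normalisation by \<open>G i\<close> the right-hand side is \<open>1\<close> and the means inequality applies.\<close>
    have "(\<integral>\<^sup>+x. (\<Prod>i\<in>I. ennpow (g i x) (\<theta> i)) \<partial>M)
        = (\<integral>\<^sup>+x. (\<Prod>i\<in>I. ennpow (G i) (\<theta> i)) * (\<Prod>i\<in>I. ennpow (g i x / G i) (\<theta> i)) \<partial>M)"
    proof (intro nn_integral_cong)
      fix x
      have "g i x = G i * (g i x / G i)" if "i \<in> I" for i
        using fin that
        by (simp add: ennreal_times_divide mult.commute[of "G i"] mult_divide_eq_ennreal)
      then have "ennpow (g i x) (\<theta> i) = ennpow (G i) (\<theta> i) * ennpow (g i x / G i) (\<theta> i)" if "i \<in> I"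
          for i
        using \<theta>(1) that by (metis ennpow_mult less_imp_le)
      then show "(\<Prod>i\<in>I. ennpow (g i x) (\<theta> i))
        = (\<Prod>i\<in>I. ennpow (G i) (\<theta> i)) * (\<Prod>i\<in>I. ennpow (g i x / G i) (\<theta> i))"
        by (simp add: prod.distrib[symmetric])
    qed
    also have "\<dots> = (\<Prod>i\<in>I. ennpow (G i) (\<theta> i)) * (\<integral>\<^sup>+x. (\<Prod>i\<in>I. ennpow (g i x / G i) (\<theta> i)) \<partial>M)"
      by (intro nn_integral_cmult) measurable
    also have "(\<integral>\<^sup>+x. (\<Prod>i\<in>I. ennpow (g i x / G i) (\<theta> i)) \<partial>M)
        \<le> (\<integral>\<^sup>+x. (\<Sum>i\<in>I. ennreal (\<theta> i) * (g i x / G i)) \<partial>M)"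
      using assms(1) \<theta> by (intro nn_integral_mono prod_ennpow_le_weighted_sum) auto
    also have "\<dots> = (\<Sum>i\<in>I. ennreal (\<theta> i) * (G i / G i))"
      by (simp add: nn_integral_sum nn_integral_cmult nn_integral_divide G_def)
    also have "\<dots> = (\<Sum>i\<in>I. ennreal (\<theta> i))"
      using fin by (intro sum.cong) (auto simp: ennreal_divide_self less_top)
    also have "\<dots> = 1"
      using \<theta> by (subst sum_ennreal) (auto simp: less_imp_le)
    finally show ?thesis by (simp add: mult_left_mono)
  qed
  then show ?thesis by (simp add: G_def)
qed

text \<open>Hoelder's inequality for a finite family. Vanishing exponents are included because they
  occur in the pointwise bound below, at the indices where \<open>p\<^sub>i'\<close> is maximal; the factors that
  they belong to are \<open>1\<close> on both sides.\<close>

lemma nn_integral_prod_ennpow_le: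
  fixes g :: "'i \<Rightarrow> 'a \<Rightarrow> ennreal"
  assumes fin: "finite I" and \<theta>: "\<And>i. i \<in> I \<Longrightarrow> \<theta> i \<ge> 0" "(\<Sum>i\<in>I. \<theta> i) = 1"
    and g: "\<And>i. i \<in> I \<Longrightarrow> g i \<in> borel_measurable M"
  shows "(\<integral>\<^sup>+x. (\<Prod>i\<in>I. ennpow (g i x) (\<theta> i)) \<partial>M) \<le> (\<Prod>i\<in>I. ennpow (\<integral>\<^sup>+x. g i x \<partial>M) (\<theta> i))"
proof -
  define J where "J = {i\<in>I. \<theta> i > 0}"
  have J: "finite J" "J \<subseteq> I" "\<forall>i\<in>I - J. \<theta> i = 0"
    using fin \<theta>(1) by (auto simp: J_def less_le)
  have "(\<Sum>i\<in>J. \<theta> i) = 1"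
    using J fin \<theta>(2) by (subst sum.mono_neutral_left[of I]) auto
  moreover have "\<theta> i > 0" "g i \<in> borel_measurable M" if "i \<in> J" for i
    using that g by (auto simp: J_def)
  ultimately have "(\<integral>\<^sup>+x. (\<Prod>i\<in>J. ennpow (g i x) (\<theta> i)) \<partial>M)
      \<le> (\<Prod>i\<in>J. ennpow (\<integral>\<^sup>+x. g i x \<partial>M) (\<theta> i))"
    using \<open>finite J\<close> by (intro nn_integral_prod_ennpow_le_pos)
  moreover have "(\<Prod>i\<in>J. ennpow (h i) (\<theta> i)) = (\<Prod>i\<in>I. ennpow (h i) (\<theta> i))" for h
    using J fin by (intro prod.mono_neutral_left) auto
  ultimately show ?thesis by simp
qed

section \<open>Maximal functions of nested partitions\<close>

text \<open>The layer cake formula for a power, at a single point.\<close>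

lemma nn_integral_powr_below:
  fixes t :: ennreal
  assumes "r > 0"
  shows "(\<integral>\<^sup>+s. ennreal (s powr (r - 1)) * indicator {s. 0 < s \<and> ennreal s < t} s \<partial>lborel)
           = ennreal (1 / r) * ennpow t r"
proof (cases t)
  case (real u)
  have "((\<lambda>x. x powr (r - 1)) has_integral (u powr (r - 1 + 1) / (r - 1 + 1))) {0..u}"
    using assms real by (intro has_integral_powr_from_0) auto
  then have I: "((\<lambda>x. x powr (r - 1)) has_integral (u powr r / r)) {0..u}" by simp
  have "(\<integral>\<^sup>+s. ennreal (s powr (r - 1)) * indicator {s. 0 < s \<and> ennreal s < t} s \<partial>lborel)
      = (\<integral>\<^sup>+s. ennreal (indicator {0..u} s * s powr (r - 1)) \<partial>lborel)"
  proof (intro nn_integral_cong_AE)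
    show "AE s in lborel. ennreal (s powr (r - 1)) * indicator {s. 0 < s \<and> ennreal s < t} s
          = ennreal (indicator {0..u} s * s powr (r - 1))"
      using AE_lborel_singleton[of 0] AE_lborel_singleton[of u]
      by eventually_elim (auto simp: real ennreal_less_iff indicator_def)
  qed
  also have "\<dots> = ennreal (u powr r / r)"
    by (intro nn_integral_has_integral_lebesgue[OF _ I]) simp
  also have "\<dots> = ennreal (1 / r) * ennpow t r"
    using real assms by (simp add: ennpow_nonneg ennreal_mult[symmetric])
  finally show ?thesis .
next
  case top
  \<comment> \<open>The upper end \<open>u\<close> is chosen such that the integral up to \<open>u\<close> is exactly \<open>n\<close>.\<close>
  have "ennreal (real n) \<le> (\<integral>\<^sup>+s. ennreal (s powr (r - 1))
      * indicator {s. 0 < s \<and> ennreal s < t} s \<partial>lborel)" for n :: nat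
  proof -
    define u where "u = (real n * r) powr (1 / r)"
    have "u \<ge> 0" by (simp add: u_def)
    have "((\<lambda>x. x powr (r - 1)) has_integral (u powr (r - 1 + 1) / (r - 1 + 1))) {0..u}"
      using assms \<open>u \<ge> 0\<close> by (intro has_integral_powr_from_0) auto
    then have I: "((\<lambda>x. x powr (r - 1)) has_integral real n) {0..u}"
      using assms by (simp add: u_def powr_powr)
    have "ennreal (real n) = (\<integral>\<^sup>+s. ennreal (indicator {0..u} s * s powr (r - 1)) \<partial>lborel)"
      by (intro nn_integral_has_integral_lebesgue[OF _ I, symmetric]) simp
    also have "\<dots> \<le> (\<integral>\<^sup>+s. ennreal (s powr (r - 1)) * indicator {s. 0 < s \<and> ennreal s < t} s \<partial>lborel)"
      by (intro nn_integral_mono) (auto simp: top indicator_def less_top[symmetric])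
    finally show ?thesis .
  qed
  then have "(\<integral>\<^sup>+s. ennreal (s powr (r - 1)) * indicator {s. 0 < s \<and> ennreal s < t} s \<partial>lborel) = top"
    by (metis ennreal_Ex_less_of_nat ennreal_of_nat_eq_real_of_nat leD less_top)
  then show ?thesis using assms top by (simp add: ennreal_mult_eq_top_iff)
qed

lemma ennreal_mult_le_of_less_divide:
  fixes a b t :: ennreal
  assumes "t < a / b"
  shows "t * b \<le> a"
proof (cases "b = 0 \<or> b = top")
  case True
  then show ?thesis using assms by (auto simp: divide_ennreal_def)
next
  case False
  have "t * b \<le> (a / b) * b" using assms by (intro mult_right_mono) auto
  also have "\<dots> = a" using False by (simp add: ennreal_divide_times ennreal_divide_self less_top)
  finally show ?thesis .
qed

definition doob_const :: "real \<Rightarrow> real" where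
  "doob_const q = 2 * q / (q - 1) * 2 powr (q - 1)"

lemma doob_const_pos: "q > 1 \<Longrightarrow> doob_const q > 0"
  by (simp add: doob_const_def)

text \<open>Finer and finer countable partitions of a measure space, given by the functions \<open>c k\<close> that
  map a point to the label of its cell at level \<open>k\<close>. The levels start at a coarsest one, so among
  the cells around a point with a given property there is a largest one. The measure is an
  arbitrary sigma-finite one: it will have a weight as density, on which the bounds must not
  depend.\<close>

locale partition_filtration = sigma_finite_measure M for M :: "'a measure" +
  fixes c :: "nat \<Rightarrow> 'a \<Rightarrow> 'k :: countable"
  assumes measurable_key [measurable]: "c k \<in> measurable M (count_space UNIV)"
    and refines: "c (Suc k) x = c (Suc k) y \<Longrightarrow> c k x = c k y"
begin

definition cell :: "nat \<Rightarrow> 'a \<Rightarrow> 'a set" where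
  "cell k x = {y \<in> space M. c k y = c k x}"

definition mean :: "nat \<Rightarrow> ('a \<Rightarrow> ennreal) \<Rightarrow> 'a \<Rightarrow> ennreal" where
  "mean k g x = (\<integral>\<^sup>+y\<in>cell k x. g y \<partial>M) / emeasure M (cell k x)"

definition maximal :: "('a \<Rightarrow> ennreal) \<Rightarrow> 'a \<Rightarrow> ennreal" where
  "maximal g x = (SUP k. mean k g x)"

lemma cell_measurable [measurable]: "cell k x \<in> sets M"
  unfolding cell_def by measurable

lemma refines_le: "k \<le> l \<Longrightarrow> c l x = c l y \<Longrightarrow> c k x = c k y"
  by (induction rule: dec_induct) (auto dest: refines)

lemma measurable_through_key:
  "(\<lambda>x. F (c k x)) \<in> measurable M (count_space UNIV)"
  by (rule measurable_compose[OF measurable_key]) simp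

lemma mean_through_key: "\<exists>F. \<forall>x. mean k g x = F (c k x)"
  by (rule exI[of _ "\<lambda>i. (\<integral>\<^sup>+y\<in>{y \<in> space M. c k y = i}. g y \<partial>M)
      / emeasure M {y \<in> space M. c k y = i}"])
     (simp add: mean_def cell_def)

lemma mean_measurable [measurable]: "mean k g \<in> borel_measurable M"
proof -
  obtain F where "\<And>x. mean k g x = F (c k x)" using mean_through_key by blast
  then have "mean k g = (\<lambda>x. F (c k x))" by auto
  then show ?thesis using measurable_through_key[of F k]
    by (metis measurable_compose measurable_key borel_measurable_count_space)
qed

lemma maximal_measurable [measurable]: "maximal g \<in> borel_measurable M"
  unfolding maximal_def by measurable

lemma mean_eq: "c k x = c k y \<Longrightarrow> mean k g x = mean k g y"
  by (simp add: mean_def cell_def)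

text \<open>Doob's maximal inequality. It holds with constant \<open>1\<close> for every measure, because the level
  set is the disjoint union of the largest cells whose mean exceeds \<open>t\<close>. Under the division
  conventions a cell of measure zero or infinity has mean zero, so it is never one of them.\<close>

lemma maximal_weak_type:
  assumes [measurable]: "g \<in> borel_measurable M"
  shows "t * emeasure M {x \<in> space M. t < maximal g x} \<le> (\<integral>\<^sup>+x. g x \<partial>M)"
proof -
  \<comment> \<open>The set where level \<open>k\<close> is the coarsest one whose mean exceeds \<open>t\<close> is a union of cells of
    level \<open>k\<close>, and on each of those the mean exceeds \<open>t\<close>.\<close>
  define A where "A k = {x \<in> space M. t < mean k g x \<and> (\<forall>j<k. \<not> t < mean j g x)}" for k
  have A_sets [measurable]: "A k \<in> sets M" for k unfolding A_def by measurable
  have A_key: "y \<in> A k" if "x \<in> A k" "y \<in> space M" "c k x = c k y" for x y k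
  proof -
    have "mean j g x = mean j g y" if "j \<le> k" for j
      using refines_le[OF that \<open>c k x = c k y\<close>] by (rule mean_eq)
    then show ?thesis using that by (simp add: A_def)
  qed
  define B where "B = (\<lambda>(k, i). {x \<in> A k. c k x = i})"
  have B_sets [measurable]: "B z \<in> sets M" for z
    unfolding B_def by (cases z) simp
  have level: "{x \<in> space M. t < maximal g x} = (\<Union>z. B z)"
  proof safe
    fix x assume "x \<in> space M" "t < maximal g x"
    then obtain k where k: "t < mean k g x" by (auto simp: maximal_def less_SUP_iff)
    define l where "l = (LEAST k. t < mean k g x)"
    have "x \<in> A l" unfolding A_def l_def
      using \<open>x \<in> space M\<close> k by (auto intro: LeastI dest: not_less_Least)
    then have "x \<in> B (l, c l x)" by (simp add: B_def)
    then show "x \<in> (\<Union>z. B z)" by blast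
  qed (auto simp: B_def A_def maximal_def less_SUP_iff)
  have A_disj: "A k \<inter> A l = {}" if "k \<noteq> l" for k l
    using that by (cases k l rule: linorder_cases) (auto simp: A_def)
  have B_disj: "disjoint_family B"
    unfolding disjoint_family_on_def
  proof (intro ballI impI)
    fix z z' :: "nat \<times> 'k" assume "z \<noteq> z'"
    then show "B z \<inter> B z' = {}"
      using A_disj[of "fst z" "fst z'"] by (cases z; cases z') (auto simp: B_def)
  qed
  have B_le: "t * emeasure M (B z) \<le> emeasure (density M g) (B z)" for z
  proof (cases "B z = {}")
    case False
    obtain k i where z: "z = (k, i)" by (cases z)
    from False obtain x where x: "x \<in> A k" "c k x = i" by (auto simp: B_def z)
    have "B z = cell k x"
      using x A_key[OF x(1)] sets.sets_into_space[OF A_sets, of k]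
      by (auto simp: B_def cell_def z)
    moreover have "t < mean k g x"
      using x by (simp add: A_def)
    then have "t * emeasure M (cell k x) \<le> (\<integral>\<^sup>+y\<in>cell k x. g y \<partial>M)"
      unfolding mean_def by (rule ennreal_mult_le_of_less_divide)
    ultimately show ?thesis by (simp add: emeasure_density)
  qed simp
  have "t * emeasure M (\<Union>z. B z) = (\<integral>\<^sup>+z. t * emeasure M (B z) \<partial>count_space UNIV)"
    using B_disj by (simp add: emeasure_UN_countable nn_integral_cmult)
  also have "\<dots> \<le> (\<integral>\<^sup>+z. emeasure (density M g) (B z) \<partial>count_space UNIV)"
    using B_le by (intro nn_integral_mono)
  also have "\<dots> = emeasure (density M g) (\<Union>z. B z)"
    using B_disj by (intro emeasure_UN_countable[symmetric]) auto
  also have "\<dots> \<le> emeasure (density M g) (space M)"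
    by (intro emeasure_mono) (auto intro!: sets.countable_UN'' simp: sets.sets_into_space)
  also have "\<dots> = (\<integral>\<^sup>+x. g x \<partial>M)"
    by (simp add: emeasure_density cong: nn_integral_cong)
  finally show ?thesis by (simp add: level)
qed

text \<open>The values of \<open>g\<close> up to \<open>t\<close> contribute at most \<open>t\<close> to every mean, so they can be cut off at
  the price of doubling the level.\<close>

lemma maximal_weak_type_truncated:
  assumes [measurable]: "g \<in> borel_measurable M"
  shows "t * emeasure M {x \<in> space M. 2 * t < maximal g x}
      \<le> (\<integral>\<^sup>+x. g x * indicator {x. t < g x} x \<partial>M)"
proof -
  define h where "h x = g x * indicator {x. t < g x} x" for x
  have [measurable]: "h \<in> borel_measurable M" unfolding h_def by measurable
  have "mean k g x \<le> mean k h x + t" for k x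
  proof -
    have "(\<integral>\<^sup>+y\<in>cell k x. g y \<partial>M) \<le> (\<integral>\<^sup>+y\<in>cell k x. (h y + t) \<partial>M)"
      by (intro nn_integral_mono mult_right_mono) (auto simp: h_def indicator_def not_less)
    also have "\<dots> = (\<integral>\<^sup>+y\<in>cell k x. h y \<partial>M) + t * emeasure M (cell k x)"
      by (simp add: distrib_right nn_integral_add nn_integral_cmult)
    finally have "mean k g x \<le> ((\<integral>\<^sup>+y\<in>cell k x. h y \<partial>M) + t * emeasure M (cell k x))
        / emeasure M (cell k x)"
      unfolding mean_def by (rule divide_right_mono_ennreal)
    also have "\<dots> = mean k h x + t * emeasure M (cell k x) / emeasure M (cell k x)"
      unfolding mean_def by (simp add: divide_ennreal_def distrib_right)
    also have "t * emeasure M (cell k x) / emeasure M (cell k x) \<le> t"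
    proof (cases "emeasure M (cell k x) = 0 \<or> emeasure M (cell k x) = top")
      case True
      then show ?thesis by (auto simp: divide_ennreal_def)
    qed (simp add: mult_divide_eq_ennreal)
    finally show ?thesis by (simp add: add_left_mono)
  qed
  then have le: "maximal g x \<le> maximal h x + t" for x
    unfolding maximal_def
    by (intro SUP_least) (rule order_trans, assumption, intro add_right_mono SUP_upper UNIV_I)
  have "{x \<in> space M. 2 * t < maximal g x} \<subseteq> {x \<in> space M. t < maximal h x}"
  proof safe
    fix x assume "2 * t < maximal g x"
    show "t < maximal h x"
    proof (rule ccontr)
      assume "\<not> t < maximal h x"
      then have "maximal h x + t \<le> t + t" by (intro add_right_mono) simp
      then have "maximal g x \<le> 2 * t"
        unfolding mult_2 by (rule order_trans[OF le])
      then show False using \<open>2 * t < maximal g x\<close> by (rule leD[THEN notE])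
    qed
  qed
  then have "t * emeasure M {x \<in> space M. 2 * t < maximal g x}
      \<le> t * emeasure M {x \<in> space M. t < maximal h x}"
    by (intro mult_left_mono emeasure_mono) auto
  also have "\<dots> \<le> (\<integral>\<^sup>+x. h x \<partial>M)" by (rule maximal_weak_type) simp
  finally show ?thesis by (simp add: h_def)
qed

text \<open>Marcinkiewicz interpolation: the truncated weak type bound is integrated over all levels.
  Since the integral at level \<open>t\<close> extends only over the points with \<open>t < g x\<close>, interchanging the
  integrals leaves for each \<open>x\<close> a power integral up to a multiple of \<open>g x\<close>. That the constant
  depends on \<open>q\<close> alone is what keeps the weight out of the constant in the main result.\<close>

lemma maximal_strong_type:
  assumes "q > 1" and g [measurable]: "g \<in> borel_measurable M"
  shows "(\<integral>\<^sup>+x. ennpow (maximal g x) q \<partial>M)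
    \<le> ennreal (doob_const q) * (\<integral>\<^sup>+x. ennpow (g x) q \<partial>M)"
proof -
  interpret pair_sigma_finite M lborel
    by (intro pair_sigma_finite.intro sigma_finite_measure_axioms sigma_finite_lborel)
  have weak: "ennreal s * emeasure M {x \<in> space M. ennreal s < maximal g x}
      \<le> 2 * (\<integral>\<^sup>+x. g x * indicator {x. ennreal s < 2 * g x} x \<partial>M)" if "s > 0" for s :: real
  proof -
    have s: "ennreal s = 2 * ennreal (s / 2)"
      using that by (simp add: ennreal_mult[symmetric] flip: ennreal_numeral)
    have iff: "ennreal s < 2 * g x \<longleftrightarrow> ennreal (s/2) < g x" for x
      unfolding s
          by (cases "g x") (auto simp: ennreal_less_iff ennreal_mult[symmetric] ennreal_mult_top that
          less_imp_le simp flip: ennreal_numeral)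
    show ?thesis
      using mult_left_mono[OF maximal_weak_type_truncated[OF g, of "ennreal (s/2)"], of 2]
      unfolding iff s[symmetric] mult.assoc[symmetric] by simp
  qed
  have "ennreal (1 / q) * (\<integral>\<^sup>+x. ennpow (maximal g x) q \<partial>M)
      = (\<integral>\<^sup>+x. \<integral>\<^sup>+s. ennreal (s powr (q - 1))
          * indicator {s. 0 < s \<and> ennreal s < maximal g x} s \<partial>lborel \<partial>M)"
    using assms(1) by (simp add: nn_integral_powr_below nn_integral_cmult)
  also have "\<dots> = (\<integral>\<^sup>+s. \<integral>\<^sup>+x. ennreal (s powr (q - 1))
      * indicator {s. 0 < s \<and> ennreal s < maximal g x} s \<partial>M \<partial>lborel)"
    by (rule Fubini'[symmetric]) measurable
  also have "\<dots> \<le> (\<integral>\<^sup>+s. \<integral>\<^sup>+x. ennreal (s powr (q - 1 - 1)) * (2 * g x)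
      * indicator {s. 0 < s \<and> ennreal s < 2 * g x} s \<partial>M \<partial>lborel)"
  proof (rule nn_integral_mono)
    fix s :: real
    show "(\<integral>\<^sup>+x. ennreal (s powr (q - 1)) * indicator {s. 0 < s \<and> ennreal s < maximal g x} s \<partial>M)
      \<le> (\<integral>\<^sup>+x. ennreal (s powr (q - 1 - 1)) * (2 * g x)
          * indicator {s. 0 < s \<and> ennreal s < 2 * g x} s \<partial>M)"
    proof (cases "s > 0")
      case True
      have "(\<integral>\<^sup>+x. ennreal (s powr (q - 1)) * indicator {s. 0 < s \<and> ennreal s < maximal g x} s \<partial>M)
         = (\<integral>\<^sup>+x. ennreal (s powr (q - 1)) * indicator {x \<in> space M. ennreal s < maximal g x} x \<partial>M)"
        using True by (intro nn_integral_cong) (auto simp: indicator_def)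
      also have "\<dots> = ennreal (s powr (q - 1)) * emeasure M {x \<in> space M. ennreal s < maximal g x}"
        by (subst nn_integral_cmult_indicator) simp_all
      also have "\<dots> = ennreal (s powr (q - 1 - 1)) * ennreal s
          * emeasure M {x \<in> space M. ennreal s < maximal g x}"
        using True by (simp add: ennreal_mult[symmetric] powr_diff power2_eq_square)
      also have "\<dots> \<le> ennreal (s powr (q - 1 - 1))
          * (2 * (\<integral>\<^sup>+x. g x * indicator {x. ennreal s < 2 * g x} x \<partial>M))"
        unfolding mult.assoc by (intro mult_left_mono weak True) simp
      also have "\<dots> = (\<integral>\<^sup>+x. ennreal (s powr (q - 1 - 1))
          * (2 * (g x * indicator {x. ennreal s < 2 * g x} x)) \<partial>M)"
        by (simp add: nn_integral_cmult)
      also have "\<dots> = (\<integral>\<^sup>+x. ennreal (s powr (q - 1 - 1)) * (2 * g x)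
          * indicator {s. 0 < s \<and> ennreal s < 2 * g x} s \<partial>M)"
        using True by (intro nn_integral_cong) (auto simp: indicator_def)
      finally show ?thesis .
    qed simp
  qed
  also have "\<dots> = (\<integral>\<^sup>+x. \<integral>\<^sup>+s. ennreal (s powr (q - 1 - 1)) * (2 * g x)
      * indicator {s. 0 < s \<and> ennreal s < 2 * g x} s \<partial>lborel \<partial>M)"
    by (rule Fubini') measurable
  also have "\<dots> = (\<integral>\<^sup>+x. 2 * g x * (ennreal (1 / (q - 1)) * ennpow (2 * g x) (q - 1)) \<partial>M)"
  proof (intro nn_integral_cong)
    fix x
    have "(\<integral>\<^sup>+s. ennreal (s powr (q - 1 - 1)) * (2 * g x)
        * indicator {s. 0 < s \<and> ennreal s < 2 * g x} s \<partial>lborel)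
        = (\<integral>\<^sup>+s. (2 * g x) * (ennreal (s powr (q - 1 - 1))
            * indicator {s. 0 < s \<and> ennreal s < 2 * g x} s) \<partial>lborel)"
      by (simp only: mult_ac)
    also have "\<dots> = 2 * g x * (ennreal (1 / (q - 1)) * ennpow (2 * g x) (q - 1))"
      using assms(1) nn_integral_powr_below[of "q - 1" "2 * g x"]
      by (subst nn_integral_cmult) simp_all
    finally show "(\<integral>\<^sup>+s. ennreal (s powr (q - 1 - 1)) * (2 * g x)
        * indicator {s. 0 < s \<and> ennreal s < 2 * g x} s \<partial>lborel)
        = 2 * g x * (ennreal (1 / (q - 1)) * ennpow (2 * g x) (q - 1))" .
  qed
  also have "\<dots> = (\<integral>\<^sup>+x. ennreal (2 / (q - 1) * 2 powr (q - 1)) * ennpow (g x) q \<partial>M)"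
  proof (intro nn_integral_cong)
    fix x
    have "ennpow (g x) q = g x * ennpow (g x) (q - 1)"
      using ennpow_add[of 1 "q - 1" "g x"] assms(1) by simp
    moreover have "ennpow (2 * g x) (q - 1) = ennreal (2 powr (q - 1)) * ennpow (g x) (q - 1)"
      using assms(1) ennpow_pos[of 2 "q - 1"] by (simp add: ennpow_mult)
    moreover have coeff: "ennreal (2 / (q - 1) * 2 powr (q - 1))
        = 2 * ennreal (1 / (q - 1)) * ennreal (2 powr (q - 1))"
      using assms(1) ennreal_mult[of 2 "1 / (q - 1)"] ennreal_mult[of "2 / (q - 1)" "2 powr (q - 1)"]
          by simp
    ultimately show "2 * g x * (ennreal (1 / (q - 1)) * ennpow (2 * g x) (q - 1))
       = ennreal (2 / (q - 1) * 2 powr (q - 1)) * ennpow (g x) q"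
      unfolding coeff by (simp only: mult_ac)
  qed
  finally have "ennreal q * (ennreal (1 / q) * (\<integral>\<^sup>+x. ennpow (maximal g x) q \<partial>M))
      \<le> ennreal q * (ennreal (2 / (q - 1) * 2 powr (q - 1)) * (\<integral>\<^sup>+x. ennpow (g x) q \<partial>M))"
    by (intro mult_left_mono) (simp_all add: nn_integral_cmult)
  moreover have "ennreal q * (ennreal (1 / q) * X) = X" for X
    using assms(1) by (simp add: mult.assoc[symmetric] ennreal_mult[symmetric])
  moreover have "ennreal q * (ennreal (2 / (q - 1) * 2 powr (q - 1)) * X)
      = ennreal (2 * q / (q - 1) * 2 powr (q - 1)) * X" for X
    using assms(1) by (simp add: mult.assoc[symmetric] ennreal_mult[symmetric])
      (simp add: mult.commute)
  ultimately show ?thesis by (simp add: doob_const_def)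
qed

end

section \<open>Shifted dyadic grids\<close>

text \<open>The dyadic grid of half-open cubes with corner \<open>s\<close>, whose level \<open>j\<close> has side length
  \<open>2\<^sup>K / 2\<^sup>j\<close>. Bounding the scale from above by \<open>2\<^sup>K\<close> provides a coarsest level and makes the
  translation by a third of \<open>2\<^sup>K\<close> useful at all levels at once.\<close>

definition grid_key :: "real ^ 'n \<Rightarrow> nat \<Rightarrow> nat \<Rightarrow> real ^ 'n \<Rightarrow> int ^ 'n" where
  "grid_key s K j x = (\<chi> i. \<lfloor>(x $ i - s $ i) / (2 ^ K / 2 ^ j)\<rfloor>)"

definition grid_cell :: "real ^ 'n \<Rightarrow> nat \<Rightarrow> nat \<Rightarrow> real ^ 'n \<Rightarrow> (real ^ 'n) set" where
  "grid_cell s K j x = {y. grid_key s K j y = grid_key s K j x}"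

lemma grid_key_refines:
  assumes "grid_key s K (Suc j) x = grid_key s K (Suc j) y"
  shows "grid_key s K j x = grid_key s K j y"
proof -
  have half: "\<lfloor>t / (2 ^ K / 2 ^ j)\<rfloor> = \<lfloor>t / (2 ^ K / 2 ^ Suc j)\<rfloor> div 2" for t :: real
    using floor_divide_real_eq_div[of 2 "t / (2 ^ K / 2 ^ Suc j)"] by simp
  have "\<lfloor>(x $ i - s $ i) / (2 ^ K / 2 ^ Suc j)\<rfloor> = \<lfloor>(y $ i - s $ i) / (2 ^ K / 2 ^ Suc j)\<rfloor>" for i
    using assms unfolding grid_key_def vec_eq_iff by simp
  then show ?thesis unfolding grid_key_def vec_eq_iff by (simp only: half vec_lambda_beta simp_thms)
qed

lemma grid_key_borel: "grid_key s K j -` {k} \<in> sets (borel :: (real ^ 'n) measure)"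
proof -
  have [measurable]: "(\<lambda>x :: real ^ 'n. x $ i) \<in> borel_measurable borel" for i
    by (intro borel_measurable_continuous_onI continuous_intros)
  have "grid_key s K j -` {k} = {x \<in> space borel. \<forall>i. \<lfloor>(x $ i - s $ i) / (2 ^ K / 2 ^ j)\<rfloor> = k $ i}"
    by (auto simp: grid_key_def vec_eq_iff)
  also have "\<dots> \<in> sets borel" by measurable
  finally show ?thesis .
qed

lemma partition_filtration_grid:
  fixes s :: "real ^ 'n"
  assumes "sigma_finite_measure M" "sets M = sets lebesgue"
  shows "partition_filtration M (grid_key s K)"
proof -
  have "space M = UNIV" using sets_eq_imp_space_eq[OF assms(2)] by simp
  then have "grid_key s K j \<in> measurable M (count_space UNIV)" for j
    using grid_key_borel[of s K j] assms(2) by (subst measurable_count_space_eq_countable) auto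
  then show ?thesis
    using assms(1) by (intro partition_filtration.intro partition_filtration_axioms.intro)
      (auto intro: grid_key_refines)
qed

lemma grid_cell_borel [measurable]: "grid_cell s K j x \<in> sets borel"
proof -
  have "grid_cell s K j x = grid_key s K j -` {grid_key s K j x}" by (auto simp: grid_cell_def)
  then show ?thesis using grid_key_borel by metis
qed

lemma emeasure_lebesgue_cube:
  fixes a b :: "real ^ 'n"
  assumes "l > 0" "\<And>i. b $ i - a $ i = l"
  shows "emeasure lebesgue (cbox a b) = ennreal (l ^ CARD('n))"
proof -
  have "a $ i \<le> b $ i" for i using assms(1) assms(2)[of i] by linarith
  then have "cbox a b \<noteq> {}" by (auto simp: interval_ne_empty_cart)
  then have "measure lborel (cbox a b) = l ^ CARD('n)"
    by (simp add: content_cbox_cart assms(2))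
  moreover have "emeasure lborel (cbox a b) \<noteq> top"
    using emeasure_lborel_cbox_finite[of a b] by simp
  ultimately show ?thesis
    by (simp add: emeasure_eq_ennreal_measure)
qed

text \<open>The weight condition refers to closed cubes and the grid consists of half-open ones; they
  differ by a null set.\<close>

lemma grid_cell_cube:
  fixes s x :: "real ^ 'n"
  obtains Q where "Q \<in> cubes" "grid_cell s K j x \<subseteq> Q" "AE y in lebesgue. y \<in> Q
      \<longleftrightarrow> y \<in> grid_cell s K j x"
    "emeasure lebesgue Q = ennreal ((2 ^ K / 2 ^ j) ^ CARD('n))"
proof -
  define h :: real where "h = 2 ^ K / 2 ^ j"
  have h: "h > 0" by (simp add: h_def)
  define k where "k i = \<lfloor>(x $ i - s $ i) / h\<rfloor>" for i
  define a :: "real ^ 'n" where "a = (\<chi> i. s $ i + real_of_int (k i) * h)"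
  define b :: "real ^ 'n" where "b = (\<chi> i. a $ i + h)"
  have cell: "y \<in> grid_cell s K j x \<longleftrightarrow> (\<forall>i. a $ i \<le> y $ i \<and> y $ i < b $ i)" for y
  proof -
    have "\<lfloor>(y $ i - s $ i) / h\<rfloor> = k i \<longleftrightarrow> a $ i \<le> y $ i \<and> y $ i < b $ i" for i
      using h by (auto simp: floor_eq_iff a_def b_def field_simps)
    then show ?thesis by (simp add: grid_cell_def grid_key_def vec_eq_iff k_def h_def)
  qed
  have sub: "box a b \<subseteq> grid_cell s K j x" "grid_cell s K j x \<subseteq> cbox a b"
    by (auto simp: cell mem_box_cart less_imp_le)
  have ba: "b $ i - a $ i = h" for i by (simp add: b_def)
  have "negligible (cbox a b - box a b)" by (rule negligible_frontier_interval)
  then have "AE y in lebesgue. y \<notin> cbox a b - box a b"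
    by (metis negligible_iff_null_sets AE_not_in)
  then have "AE y in lebesgue. y \<in> cbox a b \<longleftrightarrow> y \<in> grid_cell s K j x"
    by (rule eventually_mono) (use sub in blast)
  moreover have "cbox a b \<in> cubes" unfolding cubes_def using h ba by blast
  moreover have "emeasure lebesgue (cbox a b) = ennreal (h ^ CARD('n))"
    by (rule emeasure_lebesgue_cube[OF h ba])
  ultimately show ?thesis using that sub(2) h_def by blast
qed

lemma emeasure_grid_cell:
  fixes s x :: "real ^ 'n"
  shows "emeasure lebesgue (grid_cell s K j x) = ennreal ((2 ^ K / 2 ^ j) ^ CARD('n))"
proof -
  obtain Q where Q: "Q \<in> cubes" "grid_cell s K j x \<subseteq> Q" "AE y in lebesgue. y \<in> Q
      \<longleftrightarrow> y \<in> grid_cell s K j x"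
    "emeasure lebesgue Q = ennreal ((2 ^ K / 2 ^ j) ^ CARD('n))"
    by (rule grid_cell_cube)
  then have "emeasure lebesgue (grid_cell s K j x) = emeasure lebesgue Q"
    by (intro emeasure_eq_AE) (auto simp: cubes_def elim!: eventually_mono)
  with Q show ?thesis by simp
qed

lemma average_cong_AE:
  assumes "AE y in lebesgue. y \<in> Q \<longleftrightarrow> y \<in> R" "Q \<in> sets lebesgue" "R \<in> sets lebesgue"
  shows "average Q g = average R g"
proof -
  have "(\<integral>\<^sup>+x\<in>Q. g x \<partial>lebesgue) = (\<integral>\<^sup>+x\<in>R. g x \<partial>lebesgue)"
    by (intro nn_integral_cong_AE) (use assms(1) in eventually_elim, auto simp: indicator_def)
  moreover have "emeasure lebesgue Q = emeasure lebesgue R"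
    using assms by (intro emeasure_eq_AE)
  ultimately show ?thesis by (simp add: average_def)
qed

lemma average_grid_cell:
  fixes s x :: "real ^ 'n"
  obtains Q where "Q \<in> cubes" "\<And>g. average (grid_cell s K j x) g = average Q g"
proof -
  obtain Q where Q: "Q \<in> cubes" "grid_cell s K j x \<subseteq> Q" "AE y in lebesgue. y \<in> Q
      \<longleftrightarrow> y \<in> grid_cell s K j x"
    "emeasure lebesgue Q = ennreal ((2 ^ K / 2 ^ j) ^ CARD('n))"
    by (rule grid_cell_cube)
  from that[OF Q(1) average_cong_AE[OF Q(3), symmetric]] Q(1) show ?thesis
    by (auto simp: cubes_def)
qed

text \<open>The one-third trick. One third of the top scale \<open>H\<close> is, at every dyadic scale \<open>h\<close> below it,
  at distance at least \<open>h / 3\<close> from the multiples of \<open>h\<close>, because no power of \<open>2\<close> is divisible by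
  \<open>3\<close>. So a short interval cannot meet both the multiples of \<open>h\<close> and their translates by \<open>H / 3\<close>.\<close>

lemma floor_constant_on_short_interval:
  fixes a h l :: real
  assumes "h > 0" "3 * l \<le> h" and H: "H = 2 ^ j * h"
  shows "(\<forall>y\<in>{a..a + l}. \<lfloor>y / h\<rfloor> = \<lfloor>a / h\<rfloor>) \<or> (\<forall>y\<in>{a..a + l}. \<lfloor>(y - H / 3) / h\<rfloor> = \<lfloor>(a - H / 3) / h\<rfloor>)"
proof (rule ccontr)
  have jump: "\<exists>u::int. a < real_of_int u * h + d \<and> real_of_int u * h + d \<le> a + l"
    if y: "y \<in> {a..a + l}" "\<lfloor>(y - d) / h\<rfloor> \<noteq> \<lfloor>(a - d) / h\<rfloor>" for y d
  proof -
    have "\<lfloor>(a - d) / h\<rfloor> < \<lfloor>(y - d) / h\<rfloor>"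
      using y assms(1) floor_mono[of "(a - d) / h" "(y - d) / h"] by (simp add: divide_right_mono)
    then have "(a - d) / h < real_of_int \<lfloor>(y - d) / h\<rfloor>" by linarith
    moreover have "real_of_int \<lfloor>(y - d) / h\<rfloor> \<le> (y - d) / h" by (rule of_int_floor_le)
    then have "real_of_int \<lfloor>(y - d) / h\<rfloor> * h \<le> y - d"
      by (simp only: pos_le_divide_eq[OF assms(1)])
    ultimately show ?thesis
      using y assms(1) by (intro exI[of _ "\<lfloor>(y - d) / h\<rfloor>"]) (auto simp: field_simps)
  qed
  assume "\<not> ?thesis"
  then obtain y y' where "y \<in> {a..a + l}" "\<lfloor>(y - 0) / h\<rfloor> \<noteq> \<lfloor>(a - 0) / h\<rfloor>"
    "y' \<in> {a..a + l}" "\<lfloor>(y' - H / 3) / h\<rfloor> \<noteq> \<lfloor>(a - H / 3) / h\<rfloor>" by auto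
  from jump[OF this(1,2)] jump[OF this(3,4)] obtain u u' :: int
    where u: "a < real_of_int u * h" "real_of_int u * h \<le> a + l"
      and u': "a < real_of_int u' * h + H / 3" "real_of_int u' * h + H / 3 \<le> a + l" by auto
  have "\<bar>real_of_int u * h - (real_of_int u' * h + H / 3)\<bar> < l" using u u' by linarith
  then have "\<bar>real_of_int u * h - (real_of_int u' * h + H / 3)\<bar> * 3 < h"
    by (rule order_less_le_trans[OF mult_strict_right_mono[of _ l 3]]) (use assms(2) in auto)
  also have "real_of_int u * h - (real_of_int u' * h + H / 3)
      = (3 * (real_of_int u - real_of_int u') - 2 ^ j) / 3 * h"
    by (simp add: H field_simps)
  finally have "\<bar>3 * (real_of_int u - real_of_int u') - 2 ^ j\<bar> < 1"
    using assms(1) by (simp add: abs_mult)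
  then have "real_of_int \<bar>3 * (u - u') - 2 ^ j\<bar> < 1" by simp
  then have "3 * (u - u') = 2 ^ j" by linarith
  then have "(3::int) dvd 2 ^ j" by (metis dvd_triv_left)
  then show False using prime_dvd_power[of "3::int" 2 j] by simp
qed

definition third_shift :: "nat \<Rightarrow> 'n set \<Rightarrow> real ^ 'n" where
  "third_shift K T = (\<chi> i. if i \<in> T then 2 ^ K / 3 else 0)"

text \<open>Choosing between the two translates separately in each coordinate gives \<open>2\<^sup>n\<close> shifted grids,
  one of which contains a cell around the cube of comparable size.\<close>

lemma cube_subset_grid_cell:
  fixes Q :: "(real ^ 'n) set"
  assumes "Q \<in> cubes"
  obtains l :: real where "l > 0" "\<And>K x. 3 * l \<le> 2 ^ K \<Longrightarrow> x \<in> Q \<Longrightarrow>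
    \<exists>T j. Q \<subseteq> grid_cell (third_shift K T) K j x \<and>
      emeasure lebesgue (grid_cell (third_shift K T) K j x) \<le> 6 ^ CARD('n) * emeasure lebesgue Q"
proof -
  obtain a b l where Q: "Q = cbox a b" "l > 0" "\<And>i. b $ i - a $ i = l"
    using assms by (auto simp: cubes_def)
  have Q_le: "a $ i \<le> y $ i \<and> y $ i \<le> a $ i + l" if "y \<in> Q" for y i
  proof -
    have "a $ i \<le> y $ i" "y $ i \<le> b $ i" using that by (auto simp: Q(1) mem_box_cart)
    then show ?thesis using Q(3)[of i] by linarith
  qed
  show ?thesis
  proof (rule that[OF \<open>l > 0\<close>])
    fix K :: nat and x assume K: "3 * l \<le> 2 ^ K" and x: "x \<in> Q"
    define P where "P n \<longleftrightarrow> 2 ^ K < 3 * l * 2 ^ n" for n :: nat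
    have "\<exists>n. P n"
      using real_arch_pow[of 2 "2 ^ K / (3 * l)"] \<open>l > 0\<close> by (auto simp: P_def field_simps)
    moreover have "\<not> P 0" using K by (simp add: P_def)
    ultimately obtain j where j: "\<not> P j" "P (Suc j)"
      by (metis LeastI_ex not_less_Least not0_implies_Suc lessI)
    \<comment> \<open>\<open>h\<close> is the finest grid scale that is at least \<open>3 l\<close>, hence less than \<open>6 l\<close>.\<close>
    define h :: real where "h = 2 ^ K / 2 ^ j"
    have h: "h > 0" "3 * l \<le> h" "h < 6 * l"
      using j by (auto simp: h_def P_def field_simps)
    have H: "2 ^ K = 2 ^ j * h" by (simp add: h_def)
    define T where "T = {i. \<not> (\<forall>y\<in>{a $ i..a $ i + l}. \<lfloor>y / h\<rfloor> = \<lfloor>a $ i / h\<rfloor>)}"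
    let ?s = "third_shift K T"
    have key: "grid_key ?s K j y = grid_key ?s K j a" if "y \<in> Q" for y
      unfolding grid_key_def vec_eq_iff vec_lambda_beta h_def[symmetric]
    proof
      fix i
      have y: "y $ i \<in> {a $ i..a $ i + l}" using Q_le[OF that] by simp
      show "\<lfloor>(y $ i - ?s $ i) / h\<rfloor> = \<lfloor>(a $ i - ?s $ i) / h\<rfloor>"
      proof (cases "i \<in> T")
        case True
        then have shift: "?s $ i = 2 ^ K / 3" by (simp add: third_shift_def)
        from True have "\<not> (\<forall>y\<in>{a $ i..a $ i + l}. \<lfloor>y / h\<rfloor> = \<lfloor>a $ i / h\<rfloor>)"
          unfolding T_def by (rule CollectD)
        with floor_constant_on_short_interval[OF h(1,2) H, of "a $ i", unfolded disj_imp]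
        have "\<forall>y\<in>{a $ i..a $ i + l}. \<lfloor>(y - 2 ^ K / 3) / h\<rfloor> = \<lfloor>(a $ i - 2 ^ K / 3) / h\<rfloor>"
          by (rule mp)
        then show ?thesis using y unfolding shift by (rule bspec)
      next
        case False
        then have shift: "?s $ i = 0" by (simp add: third_shift_def)
        from False have "\<forall>y\<in>{a $ i..a $ i + l}. \<lfloor>y / h\<rfloor> = \<lfloor>a $ i / h\<rfloor>"
          unfolding T_def by blast
        then show ?thesis using y unfolding shift diff_zero by (rule bspec)
      qed
    qed
    have "Q \<subseteq> grid_cell ?s K j x"
      using key[OF x] key by (auto simp: grid_cell_def)
    moreover have "emeasure lebesgue (grid_cell ?s K j x) \<le> 6 ^ CARD('n) * emeasure lebesgue Q"
    proof -
      have "ennreal (h ^ CARD('n)) \<le> ennreal ((6 * l) ^ CARD('n))"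
        using h by (intro ennreal_leI power_mono) auto
      also have "\<dots> = 6 ^ CARD('n) * ennreal (l ^ CARD('n))"
        using Q(2) by (simp add: power_mult_distrib ennreal_mult ennreal_power[symmetric])
      finally show ?thesis
        by (simp add: emeasure_grid_cell h_def[symmetric] emeasure_lebesgue_cube[OF Q(2,3)] Q(1))
    qed
    ultimately show "\<exists>T j. Q \<subseteq> grid_cell (third_shift K T) K j x \<and>
      emeasure lebesgue (grid_cell (third_shift K T) K j x) \<le> 6 ^ CARD('n) * emeasure lebesgue Q"
      by blast
  qed
qed

lemma ennreal_inverse_antimono:
  fixes a b :: ennreal
  assumes "a \<le> b"
  shows "inverse b \<le> inverse a"
proof (cases "a = 0 \<or> b = top")
  case False
  with assms have "b \<noteq> 0" "a \<noteq> top" by (auto simp: top_unique)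
  with False assms show ?thesis
    by (cases a; cases b) (auto simp: inverse_ennreal less_le intro!: ennreal_leI le_imp_inverse_le)
qed auto

lemma average_le_superset:
  assumes "Q \<subseteq> R" "emeasure lebesgue R \<le> c * emeasure lebesgue Q"
    and "emeasure lebesgue Q \<noteq> 0" "emeasure lebesgue R \<noteq> top" "c \<noteq> top" "emeasure lebesgue R \<noteq> 0"
  shows "average Q g \<le> c * average R g"
proof -
  have I: "(\<integral>\<^sup>+x\<in>Q. g x \<partial>lebesgue) \<le> (\<integral>\<^sup>+x\<in>R. g x \<partial>lebesgue)"
    using assms(1) by (intro nn_integral_mono mult_left_mono) (auto simp: indicator_def)
  have "inverse (emeasure lebesgue Q) \<le> c * inverse (emeasure lebesgue R)"
  proof -
    have "inverse (c * emeasure lebesgue Q) \<le> inverse (emeasure lebesgue R)"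
      using assms(2) by (rule ennreal_inverse_antimono)
    then have "c * inverse (c * emeasure lebesgue Q) \<le> c * inverse (emeasure lebesgue R)"
      by (rule mult_left_mono) simp
    moreover have "c \<noteq> 0" using assms by auto
    then have "c * inverse c = 1"
      using assms(5) by (simp add: divide_ennreal_def[symmetric] ennreal_divide_self less_top)
    moreover have "inverse (c * emeasure lebesgue Q) = inverse c * inverse (emeasure lebesgue Q)"
      using assms(3,5) \<open>c \<noteq> 0\<close> by (intro ennreal_inverse_mult')
          (auto simp: less_top zero_less_iff_neq_zero)
    ultimately have "1 * inverse (emeasure lebesgue Q) \<le> c * inverse (emeasure lebesgue R)"
      by (metis mult.assoc)
    then show ?thesis by simp
  qed
  from mult_mono[OF I this] show ?thesis
    by (simp add: average_def divide_ennreal_def mult_ac)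
qed

section \<open>Multiple weights\<close>

lemma sigma_finite_lebesgue: "sigma_finite_measure (lebesgue :: 'a :: euclidean_space measure)"
proof
  obtain A :: "'a set set" where A: "countable A" "A \<subseteq> sets lborel" "\<Union>A = space lborel"
    "\<forall>a\<in>A. emeasure lborel a \<noteq> \<infinity>"
    using lborel.sigma_finite_countable by blast
  then show "\<exists>A :: 'a set set. countable A \<and> A \<subseteq> sets lebesgue \<and> \<Union>A = space lebesgue
      \<and> (\<forall>a\<in>A. emeasure lebesgue a \<noteq> \<infinity>)"
    by (intro exI[of _ A]) (auto dest: sets_completionI_sets)
qed

lemma sigma_finite_density_lebesgue:
  fixes u :: "'a :: euclidean_space \<Rightarrow> real"
  assumes "u \<in> borel_measurable lebesgue"
  shows "sigma_finite_measure (density lebesgue (\<lambda>x. ennreal (u x)))"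
  using sigma_finite_measure.sigma_finite_iff_density_finite[OF sigma_finite_lebesgue, of
      "\<lambda>x. ennreal (u x)"] assms
  by simp

lemma cube_props:
  fixes Q :: "(real ^ 'n) set"
  assumes "Q \<in> cubes"
  shows "Q \<in> sets lebesgue" "emeasure lebesgue Q \<noteq> 0" "emeasure lebesgue Q \<noteq> top"
proof -
  obtain a b l where Q: "Q = cbox a b" "l > 0" "\<And>i. b $ i - a $ i = l"
    using assms by (auto simp: cubes_def)
  then have "emeasure lebesgue Q = ennreal (l ^ CARD('n))"
    unfolding Q(1) by (intro emeasure_lebesgue_cube)
  then show "emeasure lebesgue Q \<noteq> 0" "emeasure lebesgue Q \<noteq> top" "Q \<in> sets lebesgue"
    using Q by (auto simp: ennreal_eq_0_iff not_le)
qed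

lemma average_eq_uniform:
  assumes "Q \<in> cubes" "g \<in> borel_measurable lebesgue"
  shows "average Q g = (\<integral>\<^sup>+x. g x \<partial>uniform_measure lebesgue Q)"
  using assms cube_props[OF assms(1)] by (simp add: average_def nn_integral_uniform_measure)

lemma average_pos:
  fixes u :: "real ^ 'n \<Rightarrow> real"
  assumes Q: "Q \<in> cubes" and [measurable]: "u \<in> borel_measurable lebesgue" and pos:
      "AE x in lebesgue. u x > 0"
  shows "average Q (\<lambda>x. ennreal (u x)) \<noteq> 0"
proof
  assume "average Q (\<lambda>x. ennreal (u x)) = 0"
  then have "(\<integral>\<^sup>+x\<in>Q. ennreal (u x) \<partial>lebesgue) = 0"
    using cube_props[OF Q] by (simp add: average_def ennreal_divide_eq_0_iff)
  then have "AE x in lebesgue. ennreal (u x) * indicator Q x = 0"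
    using cube_props[OF Q] by (simp add: nn_integral_0_iff_AE)
  with pos have "AE x in lebesgue. x \<notin> Q"
    by eventually_elim (auto simp: indicator_def split: if_splits)
  then have "emeasure lebesgue Q = 0"
    using cube_props(1)[OF Q] by (metis AE_iff_null_sets null_setsD1)
  with cube_props[OF Q] show False by simp
qed

lemma emeasure_uniform_cube:
  assumes "Q \<in> cubes"
  shows "emeasure (uniform_measure lebesgue Q) (space (uniform_measure lebesgue Q)) = 1"
  using cube_props[OF assms]
  by (subst emeasure_uniform_measure)
    (auto simp: ennreal_divide_self less_top zero_less_iff_neq_zero simp del: emeasure_completion)

lemma AE_uniform_cube:
  assumes "Q \<in> cubes" "AE x in lebesgue. R x"
  shows "AE x in uniform_measure lebesgue Q. R x"
  using assms cube_props[OF assms(1)] by (intro AE_uniform_measureI) auto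

text \<open>This is Hoelder's inequality applied to the constant \<open>1\<close>, written as a product of the powers
  \<open>g\<^sub>i\<close> to \<open>t c\<^sub>i\<close> with the power \<open>t\<close> of the reciprocal product. For \<open>c\<^sub>i = p / p\<^sub>i'\<close> it says that
  the multiple weight constant is at least \<open>1\<close>; with smaller exponents it controls the averages of
  the dual weights that are left over in the pointwise bound.\<close>

lemma one_le_integral_negative_powers:
  fixes g :: "nat \<Rightarrow> 'a \<Rightarrow> real"
  assumes M: "emeasure M (space M) = 1"
    and g [measurable]: "\<And>i. i < m \<Longrightarrow> g i \<in> borel_measurable M"
    and pos: "AE x in M. \<forall>i<m. g i x > 0"
    and c: "\<And>i. i < m \<Longrightarrow> c i \<ge> 0"
  shows "1 \<le> (\<integral>\<^sup>+x. ennreal (\<Prod>i<m. g i x powr (- c i)) \<partial>M)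
      * (\<Prod>i<m. ennpow (\<integral>\<^sup>+x. ennreal (g i x) \<partial>M) (c i))"
proof -
  \<comment> \<open>\<open>t\<close> normalises the exponents \<open>1, c\<^sub>0, c\<^sub>1, \<dots>\<close> to sum \<open>1\<close>; index \<open>m\<close> stands for the reciprocal product.\<close>
  define t where "t = 1 / (1 + (\<Sum>i<m. c i))"
  have sum_c: "(\<Sum>i<m. c i) \<ge> 0" using c by (intro sum_nonneg) auto
  then have t: "t > 0" by (simp add: t_def)
  define \<theta> where "\<theta> i = (if i < m then t * c i else t)" for i
  define G where "G i x = (if i < m then ennreal (g i x) else ennreal (\<Prod>i<m. g i x powr (- c i)))"
      for i x
  have [measurable]: "G i \<in> borel_measurable M" for i
    unfolding G_def by (cases "i < m") (simp_all, measurable)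
  have "(\<Sum>i<Suc m. \<theta> i) = t * (1 + (\<Sum>i<m. c i))"
    by (simp add: \<theta>_def sum_distrib_left distrib_left)
  also have "\<dots> = 1" using sum_c by (simp add: t_def)
  finally have sum1: "(\<Sum>i<Suc m. \<theta> i) = 1" .
  have "AE x in M. (\<Prod>i<Suc m. ennpow (G i x) (\<theta> i)) = 1"
    using pos
  proof eventually_elim
    case (elim x)
    have "(\<Prod>i<m. ennpow (G i x) (\<theta> i)) = (\<Prod>i<m. ennreal (g i x powr (t * c i)))"
      using elim by (intro prod.cong) (auto simp: G_def \<theta>_def ennpow_pos)
    also have "\<dots> = ennreal (\<Prod>i<m. g i x powr (t * c i))" by (simp add: prod_ennreal)
    finally have 1: "(\<Prod>i<m. ennpow (G i x) (\<theta> i)) = ennreal (\<Prod>i<m. g i x powr (t * c i))" .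
    have "ennpow (G m x) (\<theta> m) = ennreal ((\<Prod>i<m. g i x powr (- c i)) powr t)"
      using t by (simp add: G_def \<theta>_def ennpow_nonneg prod_nonneg)
    also have "(\<Prod>i<m. g i x powr (- c i)) powr t = (\<Prod>i<m. g i x powr (- (t * c i)))"
      using elim by (simp add: prod_powr_distrib powr_powr mult.commute)
    finally have 2: "ennpow (G m x) (\<theta> m) = ennreal (\<Prod>i<m. g i x powr (- (t * c i)))" .
    have "(\<Prod>i<m. g i x powr (t * c i)) * (\<Prod>i<m. g i x powr (- (t * c i))) = (\<Prod>i<m. 1)"
      unfolding prod.distrib[symmetric] using elim
      by (intro prod.cong) (auto simp: powr_add[symmetric])
    with 1 2 show ?case
      by (simp add: ennreal_mult[symmetric] prod_nonneg)
  qed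
  then have "1 = (\<integral>\<^sup>+x. (\<Prod>i<Suc m. ennpow (G i x) (\<theta> i)) \<partial>M)"
    using M by (subst nn_integral_cong_AE[where v = "\<lambda>_. 1"]) auto
  also have "\<dots> \<le> (\<Prod>i<Suc m. ennpow (\<integral>\<^sup>+x. G i x \<partial>M) (\<theta> i))"
    using sum1 t c by (intro nn_integral_prod_ennpow_le) (auto simp: \<theta>_def)
  also have "\<dots> = ennpow ((\<integral>\<^sup>+x. ennreal (\<Prod>i<m. g i x powr (- c i)) \<partial>M) *
      (\<Prod>i<m. ennpow (\<integral>\<^sup>+x. ennreal (g i x) \<partial>M) (c i))) t"
    using t c by (simp add: G_def \<theta>_def ennpow_mult ennpow_prod ennpow_ennpow mult.commute)
  finally have "ennpow 1 (1 / t) \<le> ennpow (ennpow ((\<integral>\<^sup>+x. ennreal (\<Prod>i<m. g i x powr (- c i)) \<partial>M) *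
      (\<Prod>i<m. ennpow (\<integral>\<^sup>+x. ennreal (g i x) \<partial>M) (c i))) t) (1 / t)"
    using t by (intro ennpow_mono) auto
  then show ?thesis using t by (simp add: ennpow_ennpow)
qed

lemma joint_exp_pos:
  assumes "m \<ge> 1" "\<And>i. i < m \<Longrightarrow> 1 < P i"
  shows "joint_exp m P > 0"
proof -
  have "(\<Sum>i<m. 1 / P i) > 0"
    using assms by (intro sum_pos) (force simp: lessThan_empty_iff)+
  then show ?thesis by (simp add: joint_exp_def)
qed

text \<open>A fixed multiple weight. Its components enter mostly through the dual weights \<open>\<sigma>\<^sub>i = w\<^sub>i\<close> to
  the power \<open>1 - p\<^sub>i'\<close>, in terms of which \<open>v\<close> is the product of the powers \<open>- p / p\<^sub>i'\<close> of the
  \<open>\<sigma>\<^sub>i\<close>.\<close>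

locale multiple_weight =
  fixes m :: nat and P :: "nat \<Rightarrow> real" and w :: "nat \<Rightarrow> real ^ 'n \<Rightarrow> real"
  assumes m: "m \<ge> 1" and P: "\<And>i. i < m \<Longrightarrow> 1 < P i" and w: "w \<in> AP m P"
begin

abbreviation p :: real where "p \<equiv> joint_exp m P"
abbreviation v :: "real ^ 'n \<Rightarrow> real" where "v \<equiv> joint_weight m P w"
abbreviation A :: ennreal where "A \<equiv> AP_const m P w"

definition \<sigma> :: "nat \<Rightarrow> real ^ 'n \<Rightarrow> real" where
  "\<sigma> i x = w i x powr (1 - conj_exp (P i))"

lemma w_measurable [measurable]: "i < m \<Longrightarrow> w i \<in> borel_measurable lebesgue"
  using w by (auto simp: AP_def weight_def)

lemma w_pos: "AE x in lebesgue. \<forall>i<m. w i x > 0"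
proof -
  have "AE x in lebesgue. \<forall>i\<in>{..<m}. w i x > 0"
    using w by (subst AE_ball_countable) (auto simp: AP_def weight_def)
  then show ?thesis by (auto elim: eventually_mono)
qed

lemma \<sigma>_measurable [measurable]: "i < m \<Longrightarrow> \<sigma> i \<in> borel_measurable lebesgue"
  unfolding \<sigma>_def by measurable

lemma v_measurable [measurable]: "v \<in> borel_measurable lebesgue"
  unfolding joint_weight_def by measurable

lemma \<sigma>_pos: "AE x in lebesgue. \<forall>i<m. \<sigma> i x > 0"
  using w_pos by eventually_elim (auto simp: \<sigma>_def)

lemma v_pos: "AE x in lebesgue. v x > 0"
  using w_pos by eventually_elim (auto simp: joint_weight_def intro!: prod_pos)

lemma inv_p: "1 / p = (\<Sum>i<m. 1 / P i)"
  by (simp add: joint_exp_def)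

lemma p_pos: "p > 0"
  using m P by (rule joint_exp_pos)

lemma sum_p_div_P: "(\<Sum>i<m. p / P i) = 1"
proof -
  have "(\<Sum>i<m. p / P i) = p * (\<Sum>i<m. 1 / P i)" by (simp add: sum_distrib_left)
  then show ?thesis using p_pos by (simp add: inv_p[symmetric])
qed

lemma conj_exp_gt_1: "i < m \<Longrightarrow> conj_exp (P i) > 1"
  using P[of i] by (simp add: conj_exp_def)

lemma p_div_conj: "i < m \<Longrightarrow> p / conj_exp (P i) = p - p / P i"
  using P[of i] by (simp add: conj_exp_def field_simps)

lemma \<sigma>_average_pos: "Q \<in> cubes \<Longrightarrow> i < m \<Longrightarrow> average Q (\<lambda>x. ennreal (\<sigma> i x)) \<noteq> 0"
  using \<sigma>_pos by (intro average_pos) (auto elim: eventually_mono)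

lemma v_average_pos: "Q \<in> cubes \<Longrightarrow> average Q (\<lambda>x. ennreal (v x)) \<noteq> 0"
  using v_pos by (intro average_pos) auto

lemma AP_bound:
  "Q \<in> cubes \<Longrightarrow> average Q (\<lambda>x. ennreal (v x)) *
    (\<Prod>i<m. ennpow (average Q (\<lambda>x. ennreal (\<sigma> i x))) (p / conj_exp (P i))) \<le> A"
  unfolding AP_const_def \<sigma>_def by (rule SUP_upper)

text \<open>Finiteness of the weight constant forces each average to be finite, as no factor vanishes.\<close>

lemma average_finite:
  assumes Q: "Q \<in> cubes"
  shows "average Q (\<lambda>x. ennreal (v x)) \<noteq> top" "i < m \<Longrightarrow> average Q (\<lambda>x. ennreal (\<sigma> i x)) \<noteq> top"
proof -
  let ?X = "\<Prod>i<m. ennpow (average Q (\<lambda>x. ennreal (\<sigma> i x))) (p / conj_exp (P i))"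
  have pc: "p / conj_exp (P i) > 0" if "i < m" for i
    using conj_exp_gt_1[OF that] p_pos by simp
  have "A < top" using w by (auto simp: AP_def)
  then have *: "average Q (\<lambda>x. ennreal (v x)) * ?X \<noteq> top"
    using AP_bound[OF Q] by (metis leD)
  have "?X \<noteq> 0"
    using \<sigma>_average_pos[OF Q] pc by (auto simp: ennpow_eq_0_iff)
  with * show "average Q (\<lambda>x. ennreal (v x)) \<noteq> top"
    by (auto simp: ennreal_mult_eq_top_iff)
  from * have "?X \<noteq> top" using v_average_pos[OF Q] by (auto simp: ennreal_mult_eq_top_iff)
  then show "average Q (\<lambda>x. ennreal (\<sigma> i x)) \<noteq> top" if "i < m"
    using that pc \<sigma>_average_pos[OF Q]
        by (auto simp: ennreal_prod_eq_top ennpow_eq_0_iff ennpow_eq_top_iff)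
qed

lemma v_eq_prod_\<sigma>:
  assumes "\<forall>i<m. w i x > 0"
  shows "v x = (\<Prod>i<m. \<sigma> i x powr (- (p / conj_exp (P i))))"
proof -
  have "(1 - conj_exp (P i)) * (- (p / conj_exp (P i))) = p / P i" if "i < m" for i
    using P[OF that] by (simp add: conj_exp_def field_simps)
  then show ?thesis
    unfolding joint_weight_def \<sigma>_def using assms
    by (intro prod.cong) (auto simp: powr_powr)
qed

lemma one_less_exponent:
  assumes "\<And>i. i < m \<Longrightarrow> conj_exp (P i) / p \<le> \<beta>"
  shows "\<beta> * p > 1"
proof -
  have "1 < conj_exp (P 0)" using m by (intro conj_exp_gt_1) simp
  also have "\<dots> \<le> \<beta> * p" using assms[of 0] m p_pos by (simp add: field_simps)
  finally show ?thesis .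
qed

lemma one_le_A: "1 \<le> A"
proof -
  define Q :: "(real ^ 'n) set" where "Q = cbox 0 (\<chi> i. 1)"
  have Q: "Q \<in> cubes" unfolding cubes_def Q_def
      by (intro CollectI exI conjI) (auto intro: exI[of _ 1])
  let ?U = "uniform_measure lebesgue Q"
  note U = emeasure_uniform_cube[OF Q]
  note ac = AE_uniform_cube[OF Q]
  have "1 \<le> (\<integral>\<^sup>+x. ennreal (\<Prod>i<m. \<sigma> i x powr (- (p / conj_exp (P i)))) \<partial>?U) *
      (\<Prod>i<m. ennpow (\<integral>\<^sup>+x. ennreal (\<sigma> i x) \<partial>?U) (p / conj_exp (P i)))"
    using p_pos conj_exp_gt_1 ac[OF \<sigma>_pos]
    by (intro one_le_integral_negative_powers U)
        (auto intro!: divide_nonneg_pos less_imp_le[OF p_pos] simp: less_trans[OF zero_less_one])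
  also have "(\<integral>\<^sup>+x. ennreal (\<Prod>i<m. \<sigma> i x powr (- (p / conj_exp (P i)))) \<partial>?U)
      = (\<integral>\<^sup>+x. ennreal (v x) \<partial>?U)"
    using ac[OF w_pos] by (intro nn_integral_cong_AE) (auto simp: v_eq_prod_\<sigma> elim!: eventually_mono)
  also have "\<dots> * (\<Prod>i<m. ennpow (\<integral>\<^sup>+x. ennreal (\<sigma> i x) \<partial>?U) (p / conj_exp (P i)))
     = average Q (\<lambda>x. ennreal (v x)) *
        (\<Prod>i<m. ennpow (average Q (\<lambda>x. ennreal (\<sigma> i x))) (p / conj_exp (P i)))"
    by (simp add: average_eq_uniform[OF Q] cong: prod.cong_simp)
  also have "\<dots> \<le> A" by (rule AP_bound[OF Q])
  finally show ?thesis .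
qed

end

section \<open>The bound on a dyadic grid\<close>

lemma ennreal_divide_divide_cancel:
  fixes a b e :: ennreal
  assumes "e \<noteq> 0" "e \<noteq> top"
  shows "(a / e) / (b / e) = a / b"
proof -
  have e: "inverse e * e = 1"
    using assms by (metis divide_ennreal_def ennreal_divide_self less_top mult.commute)
  have "inverse e \<noteq> 0" "inverse e \<noteq> top"
    using e assms by (auto simp: ennreal_top_mult)
  then have "0 < inverse e" "inverse e < top"
    by (simp_all only: less_top[symmetric] zero_less_iff_neq_zero not_False_eq_True)
  then have "inverse (b * inverse e) = inverse b * inverse (inverse e)"
    using assms by (intro ennreal_inverse_mult') auto
  moreover have "inverse (inverse e) = e"
    using assms by (cases e) (auto simp: inverse_ennreal less_le)
  ultimately have "(a / e) / (b / e) = a * (inverse e * e) * inverse b"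
    by (simp add: divide_ennreal_def mult_ac)
  then show ?thesis by (simp add: e divide_ennreal_def)
qed

text \<open>The dyadic maximal function with respect to the measure with density \<open>u\<close>. Dividing both
  integrals by the Lebesgue measure of the cell leaves the weighted mean unchanged and relates it
  to the averages in the weight condition.\<close>

definition grid_maximal :: "real ^ 'n \<Rightarrow> nat \<Rightarrow> (real ^ 'n \<Rightarrow> real) \<Rightarrow> (real ^ 'n \<Rightarrow> ennreal) \<Rightarrow> real ^ 'n
    \<Rightarrow> ennreal" where
  "grid_maximal s K u g x = (SUP j. average (grid_cell s K j x) (\<lambda>y. ennreal (u y) * g y) /
       average (grid_cell s K j x) (\<lambda>y. ennreal (u y)))"

lemma grid_cell_lebesgue [measurable]: "grid_cell s K j x \<in> sets lebesgue"
  using grid_cell_borel by simp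

lemma grid_cell_props:
  fixes s x :: "real ^ 'n"
  shows "emeasure lebesgue (grid_cell s K j x) \<noteq> 0" "emeasure lebesgue (grid_cell s K j x) \<noteq> top"
  unfolding emeasure_grid_cell by (auto simp: ennreal_eq_0_iff not_le)

lemma grid_maximal_eq:
  fixes s :: "real ^ 'n"
  assumes u [measurable]: "u \<in> borel_measurable lebesgue" and g [measurable]:
      "g \<in> borel_measurable lebesgue"
  shows "partition_filtration.maximal (density lebesgue (\<lambda>x. ennreal (u x))) (grid_key s K) g
      = grid_maximal s K u g"
proof -
  interpret partition_filtration "density lebesgue (\<lambda>x. ennreal (u x))" "grid_key s K"
    by (intro partition_filtration_grid sigma_finite_density_lebesgue u) simp
  have cell_eq: "cell j x = grid_cell s K j x" for j x
    by (simp add: cell_def grid_cell_def)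
  have "mean j g x = average (grid_cell s K j x) (\<lambda>y. ennreal (u y) * g y) /
       average (grid_cell s K j x) (\<lambda>y. ennreal (u y))" for j x
  proof -
    have "mean j g x = (\<integral>\<^sup>+y\<in>grid_cell s K j x. (ennreal (u y) * g y) \<partial>lebesgue)
        / (\<integral>\<^sup>+y\<in>grid_cell s K j x. ennreal (u y) \<partial>lebesgue)"
      by (simp add: mean_def cell_eq emeasure_density nn_integral_density mult.assoc)
    also have "\<dots> = average (grid_cell s K j x) (\<lambda>y. ennreal (u y) * g y) /
       average (grid_cell s K j x) (\<lambda>y. ennreal (u y))"
      unfolding average_def by (rule ennreal_divide_divide_cancel[symmetric]) (rule grid_cell_props)+
    finally show ?thesis .
  qed
  then show ?thesis by (intro ext) (simp add: maximal_def grid_maximal_def)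
qed

lemma grid_maximal_measurable:
  fixes s :: "real ^ 'n"
  assumes u [measurable]: "u \<in> borel_measurable lebesgue" and g [measurable]:
      "g \<in> borel_measurable lebesgue"
  shows "grid_maximal s K u g \<in> borel_measurable lebesgue"
proof -
  interpret partition_filtration "density lebesgue (\<lambda>x. ennreal (u x))" "grid_key s K"
    by (intro partition_filtration_grid sigma_finite_density_lebesgue u) simp
  show ?thesis using maximal_measurable[of g] by (simp add: grid_maximal_eq[OF u g])
qed

lemma grid_maximal_strong_type:
  fixes s :: "real ^ 'n"
  assumes q: "q > 1" and u [measurable]: "u \<in> borel_measurable lebesgue" and g [measurable]:
      "g \<in> borel_measurable lebesgue"
  shows "(\<integral>\<^sup>+x. ennpow (grid_maximal s K u g x) q * ennreal (u x) \<partial>lebesgue)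
     \<le> ennreal (doob_const q) * (\<integral>\<^sup>+x. ennpow (g x) q * ennreal (u x) \<partial>lebesgue)"
proof -
  interpret partition_filtration "density lebesgue (\<lambda>x. ennreal (u x))" "grid_key s K"
    by (intro partition_filtration_grid sigma_finite_density_lebesgue u) simp
  note [measurable] = grid_maximal_measurable[OF u g, of s K]
  show ?thesis
    using maximal_strong_type[OF q, of g]
    by (simp add: grid_maximal_eq[OF u g] nn_integral_density mult.commute[of "ennreal (u _)"])
qed

lemma grid_cell_eq: "y \<in> grid_cell s K j x \<Longrightarrow> grid_cell s K j y = grid_cell s K j x"
  by (simp add: grid_cell_def)

lemma grid_maximal_ge:
  assumes "y \<in> grid_cell s K j x"
  shows "average (grid_cell s K j x) (\<lambda>y. ennreal (u y) * g y) /
       average (grid_cell s K j x) (\<lambda>y. ennreal (u y)) \<le> grid_maximal s K u g y"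
  unfolding grid_maximal_def grid_cell_eq[OF assms, symmetric] by (rule SUP_upper) simp

lemma average_mono:
  "(\<And>y. y \<in> Q \<Longrightarrow> g y \<le> h y) \<Longrightarrow> average Q g \<le> average Q h"
  unfolding average_def
  by (intro divide_right_mono_ennreal nn_integral_mono) (auto simp: indicator_def)

lemma average_cong_fun_AE:
  "AE y in lebesgue. g y = h y \<Longrightarrow> average Q g = average Q h"
  unfolding average_def
  by (intro arg_cong2[where f = "(/)"] nn_integral_cong_AE) auto

lemma average_cmult:
  assumes "Q \<in> sets lebesgue" "g \<in> borel_measurable lebesgue"
  shows "average Q (\<lambda>y. c * g y) = c * average Q g"
  using assms unfolding average_def
  by (simp add: nn_integral_cmult mult.assoc ennreal_times_divide)

definition grid_product :: "nat \<Rightarrow> real ^ 'n \<Rightarrow> nat \<Rightarrow> (nat \<Rightarrow> real ^ 'n \<Rightarrow> real) \<Rightarrow> real ^ 'n \<Rightarrow> ennreal"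
    where
  "grid_product m s K f x = (SUP j. \<Prod>i<m. average (grid_cell s K j x) (\<lambda>y. ennreal \<bar>f i y\<bar>))"

lemma grid_product_measurable:
  fixes s :: "real ^ 'n"
  assumes [measurable]: "\<And>i. i < m \<Longrightarrow> f i \<in> borel_measurable lebesgue"
  shows "grid_product m s K f \<in> borel_measurable lebesgue"
proof -
  interpret partition_filtration lebesgue "grid_key s K"
    by (intro partition_filtration_grid sigma_finite_lebesgue) simp
  have "average (grid_cell s K j x) g = mean j g x" for j x g
    by (simp add: average_def mean_def cell_def grid_cell_def)
  then show ?thesis unfolding grid_product_def by simp
qed

context multiple_weight
begin

lemma average_cell_facts:
  fixes s x :: "real ^ 'n" and K j :: nat
  defines "R \<equiv> \<lambda>j. grid_cell s K j x"
  shows "average (R j) (\<lambda>x. ennreal (v x)) \<noteq> 0" "average (R j) (\<lambda>x. ennreal (v x)) \<noteq> top"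
    "i < m \<Longrightarrow> average (R j) (\<lambda>x. ennreal (\<sigma> i x)) \<noteq> 0" "i < m
        \<Longrightarrow> average (R j) (\<lambda>x. ennreal (\<sigma> i x)) \<noteq> top"
    "average (R j) (\<lambda>x. ennreal (v x)) *
      (\<Prod>i<m. ennpow (average (R j) (\<lambda>x. ennreal (\<sigma> i x))) (p / conj_exp (P i))) \<le> A"
proof -
  obtain Q where Q: "Q \<in> cubes" "\<And>g. average (R j) g = average Q g"
    unfolding R_def using average_grid_cell[of s K j x] by blast
  show "average (R j) (\<lambda>x. ennreal (v x)) \<noteq> 0" "average (R j) (\<lambda>x. ennreal (v x)) \<noteq> top"
    "i < m \<Longrightarrow> average (R j) (\<lambda>x. ennreal (\<sigma> i x)) \<noteq> 0" "i < m
        \<Longrightarrow> average (R j) (\<lambda>x. ennreal (\<sigma> i x)) \<noteq> top"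
    "average (R j) (\<lambda>x. ennreal (v x)) *
      (\<Prod>i<m. ennpow (average (R j) (\<lambda>x. ennreal (\<sigma> i x))) (p / conj_exp (P i))) \<le> A"
    unfolding Q(2)
        using v_average_pos[OF Q(1)] \<sigma>_average_pos[OF Q(1)] average_finite[OF Q(1)] AP_bound[OF Q(1)]
    by auto
qed

lemma one_le_average_negative_powers:
  fixes s x :: "real ^ 'n"
  assumes "\<And>i. i < m \<Longrightarrow> c i \<ge> 0"
  shows "1 \<le> average (grid_cell s K j x) (\<lambda>y. ennreal (\<Prod>i<m. \<sigma> i y powr (- c i))) *
    (\<Prod>i<m. ennpow (average (grid_cell s K j x) (\<lambda>x. ennreal (\<sigma> i x))) (c i))"
proof -
  obtain Q where Q: "Q \<in> cubes" "\<And>g. average (grid_cell s K j x) g = average Q g"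
    using average_grid_cell[of s K j x] by blast
  from one_le_integral_negative_powers[OF emeasure_uniform_cube, OF Q(1), of m \<sigma> c]
    assms AE_uniform_cube[OF Q(1) \<sigma>_pos] show ?thesis
    unfolding Q(2) by (simp add: average_eq_uniform[OF Q(1)] cong: prod.cong_simp)
qed

text \<open>The pointwise domination on which the sharp exponent rests. On a cell, with \<open>a\<^sub>i\<close>, \<open>a\<^sub>0\<close> the
  averages of \<open>\<sigma>\<^sub>i\<close> and \<open>v\<close>, an average of \<open>f\<^sub>i\<close> is \<open>a\<^sub>i\<close> times the \<open>\<sigma>\<^sub>i\<close>-mean \<open>X\<^sub>i\<close> of
  \<open>f\<^sub>i / \<sigma>\<^sub>i\<close>. The power \<open>\<beta>\<close> of the weight condition bounds the product of the powers
  \<open>\<beta> p / p\<^sub>i' \<ge> 1\<close> of the \<open>a\<^sub>i\<close>, hence more than is needed of each factor. The surplus powers are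
  turned into an average of negative powers of the \<open>\<sigma>\<^sub>i\<close>, and dividing by \<open>a\<^sub>0\<close> makes it a mean
  with respect to \<open>v\<close>. As \<open>X\<^sub>i\<close> is at most the dyadic maximal function \<open>S\<^sub>i\<close> throughout the cell,
  it can be moved into this mean.\<close>

lemma grid_product_le:
  fixes s x :: "real ^ 'n" and K :: nat and f :: "nat \<Rightarrow> real ^ 'n \<Rightarrow> real"
  assumes f [measurable]: "\<And>i. i < m \<Longrightarrow> f i \<in> borel_measurable lebesgue"
    and \<beta>: "\<beta> > 0" "\<And>i. i < m \<Longrightarrow> conj_exp (P i) / p \<le> \<beta>"
  defines "c \<equiv> \<lambda>i. p / conj_exp (P i) - 1 / \<beta>"
  defines "S \<equiv> \<lambda>i. grid_maximal s K (\<sigma> i) (\<lambda>x. ennreal (\<bar>f i x\<bar> / \<sigma> i x))"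
  defines "h \<equiv> \<lambda>x. (\<Prod>i<m. ennpow (S i x) (1 / \<beta>)) * ennreal ((\<Prod>i<m. \<sigma> i x powr (- c i)) / v x)"
  shows "grid_product m s K f x \<le> ennpow (A * grid_maximal s K v h x) \<beta>"
  unfolding grid_product_def
proof (rule SUP_least)
  fix j
  let ?R = "grid_cell s K j x"
  define a where "a i = average ?R (\<lambda>y. ennreal (\<sigma> i y))" for i
  define a0 where "a0 = average ?R (\<lambda>y. ennreal (v y))"
  define J where "J = average ?R (\<lambda>y. ennreal (\<Prod>i<m. \<sigma> i y powr (- c i)))"
  define X where "X i = average ?R (\<lambda>y. ennreal \<bar>f i y\<bar>) / a i" for i
  note facts = average_cell_facts[where s = s and K = K and x = x and j = j, folded a0_def a_def]
  have c: "c i \<ge> 0" if "i < m" for i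
    using \<beta>(2)[OF that] \<beta>(1) p_pos conj_exp_gt_1[OF that] by (simp add: c_def field_simps)
  have X: "average ?R (\<lambda>y. ennreal \<bar>f i y\<bar>) = X i * a i" if "i < m" for i
    using facts(3,4)[OF that] by (simp add: X_def ennreal_divide_times ennreal_divide_self less_top)
  have X_le: "X i \<le> S i y" if "i < m" "y \<in> ?R" for i y
  proof -
    have "average ?R (\<lambda>y. ennreal (\<sigma> i y) * ennreal (\<bar>f i y\<bar> / \<sigma> i y))
        = average ?R (\<lambda>y. ennreal \<bar>f i y\<bar>)"
      by (intro average_cong_fun_AE eventually_mono[OF \<sigma>_pos])
        (use that in \<open>auto simp: ennreal_mult[symmetric]\<close>)
    then show ?thesis
      using grid_maximal_ge[OF that(2), of "\<sigma> i" "\<lambda>y. ennreal (\<bar>f i y\<bar> / \<sigma> i y)"]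
      by (simp add: S_def X_def a_def)
  qed
  have "(\<Prod>i<m. ennpow (X i) (1 / \<beta>)) * J
      = average ?R (\<lambda>y. (\<Prod>i<m. ennpow (X i) (1 / \<beta>)) * ennreal (\<Prod>i<m. \<sigma> i y powr (- c i)))"
    unfolding J_def by (intro average_cmult[symmetric]) measurable
  also have "\<dots> \<le> average ?R (\<lambda>y. (\<Prod>i<m. ennpow (S i y) (1 / \<beta>)) * ennreal (\<Prod>i<m. \<sigma> i y powr (- c i)))"
  proof (intro average_mono mult_right_mono)
    fix y assume "y \<in> ?R"
    then show "(\<Prod>i<m. ennpow (X i) (1 / \<beta>)) \<le> (\<Prod>i<m. ennpow (S i y) (1 / \<beta>))"
      using X_le \<beta>(1) by (intro prod_mono_ennreal ennpow_mono) auto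
  qed simp
  also have "\<dots> = average ?R (\<lambda>y. ennreal (v y) * h y)"
  proof (intro average_cong_fun_AE eventually_mono[OF v_pos])
    fix y assume "v y > 0"
    then have "ennreal (\<Prod>i<m. \<sigma> i y powr (- c i))
        = ennreal (v y) * ennreal ((\<Prod>i<m. \<sigma> i y powr (- c i)) / v y)"
      by (simp add: ennreal_mult[symmetric] prod_nonneg)
    then show "(\<Prod>i<m. ennpow (S i y) (1 / \<beta>)) * ennreal (\<Prod>i<m. \<sigma> i y powr (- c i))
        = ennreal (v y) * h y"
      by (simp add: h_def mult_ac)
  qed
  finally have "(\<Prod>i<m. ennpow (X i) (1 / \<beta>)) * J / a0 \<le> average ?R (\<lambda>y. ennreal (v y) * h y) / a0"
    by (rule divide_right_mono_ennreal)
  also have "\<dots> \<le> grid_maximal s K v h x"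
    unfolding a0_def by (rule grid_maximal_ge) (simp add: grid_cell_def)
  finally have mean_h: "(\<Prod>i<m. ennpow (X i) (1 / \<beta>)) * J / a0 \<le> grid_maximal s K v h x" .
  \<comment> \<open>The exponents \<open>c\<^sub>i\<close> complement \<open>1 / \<beta>\<close> to the exponents \<open>p / p\<^sub>i'\<close> of the weight condition.\<close>
  have "(\<Prod>i<m. ennpow (a i) (1 / \<beta>)) * 1
      \<le> (\<Prod>i<m. ennpow (a i) (1 / \<beta>)) * (J * (\<Prod>i<m. ennpow (a i) (c i)))"
    unfolding J_def a_def by (intro mult_left_mono one_le_average_negative_powers c) auto
  also have "\<dots> = J * (\<Prod>i<m. ennpow (a i) (1 / \<beta>) * ennpow (a i) (c i))"
    by (simp add: prod.distrib mult_ac)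
  also have "\<dots> = J * (\<Prod>i<m. ennpow (a i) (p / conj_exp (P i)))"
    using \<beta>(1) c by (intro arg_cong2[where f = "(*)"] prod.cong refl)
        (simp add: ennpow_add[symmetric] c_def)
  also have "\<dots> = J * (a0 / a0 * (\<Prod>i<m. ennpow (a i) (p / conj_exp (P i))))"
    using facts(1,2) by (simp add: ennreal_divide_self less_top zero_less_iff_neq_zero)
  also have "\<dots> = J / a0 * (a0 * (\<Prod>i<m. ennpow (a i) (p / conj_exp (P i))))"
    by (simp add: divide_ennreal_def mult_ac)
  also have "\<dots> \<le> J / a0 * A"
    by (intro mult_left_mono facts(5)) simp
  finally have a_le: "(\<Prod>i<m. ennpow (a i) (1 / \<beta>)) \<le> J / a0 * A" by simp
  have "ennpow (\<Prod>i<m. average ?R (\<lambda>y. ennreal \<bar>f i y\<bar>)) (1 / \<beta>)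
      = (\<Prod>i<m. ennpow (X i) (1 / \<beta>)) * (\<Prod>i<m. ennpow (a i) (1 / \<beta>))"
    using X \<beta>(1) by (simp add: ennpow_prod ennpow_mult prod.distrib[symmetric])
  also have "\<dots> \<le> (\<Prod>i<m. ennpow (X i) (1 / \<beta>)) * (J / a0 * A)"
    by (intro mult_left_mono a_le) simp
  also have "\<dots> = A * ((\<Prod>i<m. ennpow (X i) (1 / \<beta>)) * J / a0)"
    by (simp add: divide_ennreal_def mult_ac)
  also have "\<dots> \<le> A * grid_maximal s K v h x"
    by (intro mult_left_mono mean_h) simp
  finally show "(\<Prod>i<m. average ?R (\<lambda>y. ennreal \<bar>f i y\<bar>)) \<le> ennpow (A * grid_maximal s K v h x) \<beta>"
    using \<beta>(1) by (subst (asm) ennpow_le_iff) auto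
qed

text \<open>The exponents balance for every \<open>\<beta>\<close>: the factor of \<open>h\<close> that contains no maximal function
  becomes, in \<open>h\<close> to the power \<open>\<beta> p\<close> times \<open>v\<close>, just the weights needed for Hoelder's inequality
  with the exponents \<open>p / p\<^sub>i\<close>.\<close>

lemma dual_weight_identity:
  assumes w: "\<forall>i<m. w i x > 0" and \<beta>: "\<beta> > 0"
  shows "((\<Prod>i<m. \<sigma> i x powr (- (p / conj_exp (P i) - 1 / \<beta>))) / v x) powr (\<beta> * p) * v x
     = (\<Prod>i<m. \<sigma> i x powr (p / P i))"
proof -
  have \<sigma>: "\<sigma> i x > 0" if "i < m" for i using w that by (auto simp: \<sigma>_def)
  have v: "v x > 0" using w by (auto simp: joint_weight_def intro!: prod_pos)
  have "((\<Prod>i<m. \<sigma> i x powr (- (p / conj_exp (P i) - 1 / \<beta>))) / v x) powr (\<beta> * p) * v x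
      = (\<Prod>i<m. \<sigma> i x powr (- (p / conj_exp (P i) - 1 / \<beta>))) powr (\<beta> * p) * v x powr (1 - \<beta> * p)"
    using v by (simp add: powr_divide prod_nonneg powr_diff)
  also have "(\<Prod>i<m. \<sigma> i x powr (- (p / conj_exp (P i) - 1 / \<beta>))) powr (\<beta> * p)
     = (\<Prod>i<m. \<sigma> i x powr (- (p / conj_exp (P i) - 1 / \<beta>) * (\<beta> * p)))"
    using \<sigma> by (simp add: prod_powr_distrib powr_powr)
  also have "v x powr (1 - \<beta> * p) = (\<Prod>i<m. \<sigma> i x powr (- (p / conj_exp (P i)) * (1 - \<beta> * p)))"
    using \<sigma> by (simp add: v_eq_prod_\<sigma>[OF w] prod_powr_distrib powr_powr)
  also have "(\<Prod>i<m. \<sigma> i x powr (- (p / conj_exp (P i) - 1 / \<beta>) * (\<beta> * p))) * \<dots>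
     = (\<Prod>i<m. \<sigma> i x powr (p / P i))"
    unfolding prod.distrib[symmetric]
  proof (intro prod.cong refl)
    fix i assume "i \<in> {..<m}"
    then have i: "i < m" by simp
    have "- (p / conj_exp (P i) - 1 / \<beta>) * (\<beta> * p) + - (p / conj_exp (P i)) * (1 - \<beta> * p) = p / P i"
    proof -
      have "- (X - 1 / \<beta>) * (\<beta> * p) + - X * (1 - \<beta> * p) = p - X" for X
        using \<beta> by (simp add: algebra_simps)
      from this[of "p - p / P i"] show ?thesis unfolding p_div_conj[OF i] by simp
    qed
    then show "\<sigma> i x powr (- (p / conj_exp (P i) - 1 / \<beta>) * (\<beta> * p))
        * \<sigma> i x powr (- (p / conj_exp (P i)) * (1 - \<beta> * p))
       = \<sigma> i x powr (p / P i)"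
      by (simp only: powr_add[symmetric])
  qed
  finally show ?thesis .
qed

lemma \<sigma>_norm:
  fixes f :: "nat \<Rightarrow> real ^ 'n \<Rightarrow> real"
  assumes "i < m"
  shows "(\<integral>\<^sup>+x. ennpow (ennreal (\<bar>f i x\<bar> / \<sigma> i x)) (P i) * ennreal (\<sigma> i x) \<partial>lebesgue)
    = (\<integral>\<^sup>+x. ennpow (ennreal \<bar>f i x\<bar>) (P i) * ennreal (w i x) \<partial>lebesgue)"
proof (intro nn_integral_cong_AE eventually_mono[OF w_pos])
  fix x assume "\<forall>i<m. w i x > 0"
  with assms have w: "w i x > 0" by simp
  then have \<sigma>: "\<sigma> i x > 0" by (simp add: \<sigma>_def)
  have P': "P i > 1" by (rule P[OF assms])
  have "(\<bar>f i x\<bar> / \<sigma> i x) powr P i * \<sigma> i x = \<bar>f i x\<bar> powr P i * \<sigma> i x powr (1 - P i)"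
    using \<sigma> by (simp add: powr_divide powr_diff)
  also have "(1 - conj_exp (P i)) * (1 - P i) = 1"
    using P' by (simp add: conj_exp_def field_simps)
  then have "\<sigma> i x powr (1 - P i) = w i x" using w by (simp add: \<sigma>_def powr_powr)
  finally show "ennpow (ennreal (\<bar>f i x\<bar> / \<sigma> i x)) (P i) * ennreal (\<sigma> i x)
      = ennpow (ennreal \<bar>f i x\<bar>) (P i) * ennreal (w i x)"
    using P' \<sigma> w by (simp add: ennpow_nonneg ennreal_mult[symmetric])
qed

text \<open>Two layers of maximal functions are removed one after the other: first the outer one, with
  respect to \<open>v\<close> on the exponent \<open>\<beta> p\<close>, then, after Hoelder's inequality, the \<open>S\<^sub>i\<close> with respect
  to \<open>\<sigma>\<^sub>i\<close> on the exponents \<open>p\<^sub>i\<close>. Neither costs a constant depending on the weights.\<close>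

lemma grid_product_bound:
  fixes s :: "real ^ 'n" and f :: "nat \<Rightarrow> real ^ 'n \<Rightarrow> real"
  assumes f [measurable]: "\<And>i. i < m \<Longrightarrow> f i \<in> borel_measurable lebesgue"
    and \<beta>: "\<And>i. i < m \<Longrightarrow> conj_exp (P i) / p \<le> \<beta>"
  shows "(\<integral>\<^sup>+x. ennpow (grid_product m s K f x) p * ennreal (v x) \<partial>lebesgue)
    \<le> ennpow A (\<beta> * p) * ennreal (doob_const (\<beta> * p) * (\<Prod>i<m. doob_const (P i) powr (p / P i)))
       * (\<Prod>i<m. ennpow (\<integral>\<^sup>+x. ennpow (ennreal \<bar>f i x\<bar>) (P i) * ennreal (w i x) \<partial>lebesgue) (p / P i))"
proof -
  have q: "\<beta> * p > 1" using \<beta> by (rule one_less_exponent)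
  then have "\<beta> > 0" using p_pos by (metis less_trans zero_less_one zero_less_mult_pos2)
  define c where "c = (\<lambda>i. p / conj_exp (P i) - 1 / \<beta>)"
  define S where "S = (\<lambda>i. grid_maximal s K (\<sigma> i) (\<lambda>x. ennreal (\<bar>f i x\<bar> / \<sigma> i x)))"
  define h where "h = (\<lambda>x. (\<Prod>i<m. ennpow (S i x) (1 / \<beta>))
      * ennreal ((\<Prod>i<m. \<sigma> i x powr (- c i)) / v x))"
  have S [measurable]: "S i \<in> borel_measurable lebesgue" if "i < m" for i
    unfolding S_def using that by (intro grid_maximal_measurable) measurable
  have h [measurable]: "h \<in> borel_measurable lebesgue"
    unfolding h_def by measurable
  have doob_nonneg: "doob_const r \<ge> 0" if "r > 1" for r
    using that by (simp add: doob_const_def)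
  note [measurable] = grid_maximal_measurable[OF v_measurable h, of s K]
  have "(\<integral>\<^sup>+x. ennpow (grid_product m s K f x) p * ennreal (v x) \<partial>lebesgue)
     \<le> (\<integral>\<^sup>+x. ennpow A (\<beta> * p) * (ennpow (grid_maximal s K v h x) (\<beta> * p) * ennreal (v x)) \<partial>lebesgue)"
  proof (intro nn_integral_mono)
    fix x
    have "ennpow (grid_product m s K f x) p \<le> ennpow (ennpow (A * grid_maximal s K v h x) \<beta>) p"
      unfolding h_def S_def c_def using p_pos
      by (intro ennpow_mono grid_product_le f \<beta> \<open>\<beta> > 0\<close>) auto
    also have "\<dots> = ennpow A (\<beta> * p) * ennpow (grid_maximal s K v h x) (\<beta> * p)"
      using p_pos \<open>\<beta> > 0\<close> by (simp add: ennpow_ennpow ennpow_mult)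
    finally show "ennpow (grid_product m s K f x) p * ennreal (v x)
      \<le> ennpow A (\<beta> * p) * (ennpow (grid_maximal s K v h x) (\<beta> * p) * ennreal (v x))"
      by (simp add: mult_right_mono mult.assoc[symmetric])
  qed
  also have "\<dots> = ennpow A (\<beta> * p) * (\<integral>\<^sup>+x. ennpow (grid_maximal s K v h x) (\<beta> * p)
      * ennreal (v x) \<partial>lebesgue)"
    by (intro nn_integral_cmult) measurable
  also have "\<dots> \<le> ennpow A (\<beta> * p) * (ennreal (doob_const (\<beta> * p))
      * (\<integral>\<^sup>+x. ennpow (h x) (\<beta> * p) * ennreal (v x) \<partial>lebesgue))"
    using q by (intro mult_left_mono grid_maximal_strong_type) measurable
  also have "(\<integral>\<^sup>+x. ennpow (h x) (\<beta> * p) * ennreal (v x) \<partial>lebesgue)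
      = (\<integral>\<^sup>+x. (\<Prod>i<m. ennpow (ennpow (S i x) (P i) * ennreal (\<sigma> i x)) (p / P i)) \<partial>lebesgue)"
  proof (intro nn_integral_cong_AE eventually_mono[OF w_pos])
    fix x assume wx: "\<forall>i<m. w i x > 0"
    have \<sigma>: "\<sigma> i x > 0" if "i < m" for i using wx that by (auto simp: \<sigma>_def)
    have vx: "v x > 0" using wx by (auto simp: joint_weight_def intro!: prod_pos)
    define U where "U = (\<Prod>i<m. \<sigma> i x powr (- c i)) / v x"
    have U: "U > 0" unfolding U_def using vx by (intro divide_pos_pos prod_pos) (auto dest: \<sigma>)
    have "ennpow (h x) (\<beta> * p) * ennreal (v x)
        = (\<Prod>i<m. ennpow (S i x) p) * (ennreal (U powr (\<beta> * p)) * ennreal (v x))"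
      using U q p_pos \<open>\<beta> > 0\<close>
      by (simp add: h_def U_def[symmetric] ennpow_mult ennpow_prod ennpow_ennpow ennpow_pos
          mult.assoc)
    also have "ennreal (U powr (\<beta> * p)) * ennreal (v x) = ennreal (\<Prod>i<m. \<sigma> i x powr (p / P i))"
      using dual_weight_identity[OF wx \<open>\<beta> > 0\<close>] vx
      by (simp add: U_def c_def ennreal_mult[symmetric])
    also have "\<dots> = (\<Prod>i<m. ennreal (\<sigma> i x powr (p / P i)))" by (simp add: prod_ennreal)
    also have "(\<Prod>i<m. ennpow (S i x) p) * \<dots>
        = (\<Prod>i<m. ennpow (ennpow (S i x) (P i) * ennreal (\<sigma> i x)) (p / P i))"
      unfolding prod.distrib[symmetric]
    proof (intro prod.cong refl)
      fix i assume "i \<in> {..<m}"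
      then have i: "i < m" by simp
      show "ennpow (S i x) p * ennreal (\<sigma> i x powr (p / P i))
          = ennpow (ennpow (S i x) (P i) * ennreal (\<sigma> i x)) (p / P i)"
        using P[OF i] p_pos \<sigma>[OF i] by (simp add: ennpow_mult ennpow_ennpow ennpow_pos)
    qed
    finally show "ennpow (h x) (\<beta> * p) * ennreal (v x)
       = (\<Prod>i<m. ennpow (ennpow (S i x) (P i) * ennreal (\<sigma> i x)) (p / P i))" .
  qed
  also have "\<dots> \<le> (\<Prod>i<m. ennpow (\<integral>\<^sup>+x. ennpow (S i x) (P i) * ennreal (\<sigma> i x) \<partial>lebesgue) (p / P i))"
    using p_pos P sum_p_div_P
    by (intro nn_integral_prod_ennpow_le) (auto intro!: divide_nonneg_nonneg dest: P)
  also have "\<dots> \<le> (\<Prod>i<m. ennpow (ennreal (doob_const (P i)) *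
      (\<integral>\<^sup>+x. ennpow (ennreal \<bar>f i x\<bar>) (P i) * ennreal (w i x) \<partial>lebesgue)) (p / P i))"
  proof (intro prod_mono_ennreal ennpow_mono)
    fix i assume "i \<in> {..<m}"
    then have i: "i < m" by simp
    show "p / P i \<ge> 0" using p_pos P[OF i] by simp
    show "(\<integral>\<^sup>+x. ennpow (S i x) (P i) * ennreal (\<sigma> i x) \<partial>lebesgue) \<le> ennreal (doob_const (P i)) *
      (\<integral>\<^sup>+x. ennpow (ennreal \<bar>f i x\<bar>) (P i) * ennreal (w i x) \<partial>lebesgue)"
      unfolding \<sigma>_norm[OF i, symmetric] S_def using i
      by (intro grid_maximal_strong_type P) measurable
  qed
  also have "\<dots> = (\<Prod>i<m. ennreal (doob_const (P i) powr (p / P i)) *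
      ennpow (\<integral>\<^sup>+x. ennpow (ennreal \<bar>f i x\<bar>) (P i) * ennreal (w i x) \<partial>lebesgue) (p / P i))"
  proof (intro prod.cong refl)
    fix i assume "i \<in> {..<m}"
    then show "ennpow (ennreal (doob_const (P i))
        * (\<integral>\<^sup>+x. ennpow (ennreal \<bar>f i x\<bar>) (P i) * ennreal (w i x) \<partial>lebesgue)) (p / P i)
      = ennreal (doob_const (P i) powr (p / P i)) *
        ennpow (\<integral>\<^sup>+x. ennpow (ennreal \<bar>f i x\<bar>) (P i) * ennreal (w i x) \<partial>lebesgue) (p / P i)"
      using P[of i] p_pos doob_nonneg[of "P i"] by (simp add: ennpow_mult ennpow_nonneg)
  qed
  finally show ?thesis
    using doob_nonneg[OF q]
    by (simp add: prod.distrib prod_ennreal ennreal_mult prod_nonneg mult.assoc mult_left_mono)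
qed

end

section \<open>The bound for the maximal function\<close>

text \<open>A cube through \<open>x\<close> lies in a comparable cell of one of the grids of top scale \<open>2\<^sup>K\<close> as soon
  as \<open>K\<close> is large. As the grids for different \<open>K\<close> are unrelated, the bounds need not be
  monotone in \<open>K\<close>, and the lower limit, to which Fatou's lemma applies, takes the place of a supremum.\<close>

lemma multi_maximal_le_liminf_grid_products:
  fixes f :: "nat \<Rightarrow> real ^ 'n \<Rightarrow> real" and x :: "real ^ 'n"
  assumes "p > 0"
  shows "ennpow (multi_maximal m f x) p * y \<le>
    liminf (\<lambda>K. \<Sum>T\<in>UNIV. ennreal (((6 ^ CARD('n)) ^ m) powr p)
        * (ennpow (grid_product m (third_shift K T) K f x) p * y))"
    (is "_ \<le> liminf ?G")
proof -
  let ?F = "\<lambda>Q. \<Prod>i<m. average Q (\<lambda>y. ennreal \<bar>f i y\<bar>)"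
  have "ennpow (multi_maximal m f x) p \<le> (SUP Q \<in> {Q \<in> cubes. x \<in> Q}. ennpow (?F Q) p)"
    unfolding multi_maximal_def using assms by (intro ennpow_SUP_le) (auto intro: SUP_upper)
  then have "ennpow (multi_maximal m f x) p * y \<le> (SUP Q \<in> {Q \<in> cubes. x \<in> Q}. ennpow (?F Q) p) * y"
    by (rule mult_right_mono) simp
  also have "\<dots> = (SUP Q \<in> {Q \<in> cubes. x \<in> Q}. ennpow (?F Q) p * y)"
    by (rule SUP_mult_right_ennreal)
  also have "\<dots> \<le> liminf ?G"
  proof (intro SUP_least Liminf_bounded)
    fix Q :: "(real ^ 'n) set" assume "Q \<in> {Q \<in> cubes. x \<in> Q}"
    then have Q: "Q \<in> cubes" "x \<in> Q" by auto
    obtain l :: real where l: "l > 0" "\<And>K x. 3 * l \<le> 2 ^ K \<Longrightarrow> x \<in> Q \<Longrightarrow>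
      \<exists>T j. Q \<subseteq> grid_cell (third_shift K T) K j x \<and>
        emeasure lebesgue (grid_cell (third_shift K T) K j x) \<le> 6 ^ CARD('n) * emeasure lebesgue Q"
      using cube_subset_grid_cell[OF Q(1)] by blast
    obtain K0 where K0: "3 * l < 2 ^ K0" using real_arch_pow[of 2 "3 * l"] by auto
    have "ennpow (?F Q) p * y \<le> ?G K" if "K \<ge> K0" for K
    proof -
      have "3 * l \<le> 2 ^ K" using K0 that power_increasing[of K0 K "2::real"] by linarith
      from l(2)[OF this Q(2)] obtain T j where T: "Q \<subseteq> grid_cell (third_shift K T) K j x"
        "emeasure lebesgue (grid_cell (third_shift K T) K j x) \<le> 6 ^ CARD('n) * emeasure lebesgue Q"
            by blast
      let ?R = "grid_cell (third_shift K T) K j x"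
      have "?F Q \<le> (\<Prod>i<m. 6 ^ CARD('n) * average ?R (\<lambda>y. ennreal \<bar>f i y\<bar>))"
        by (intro prod_mono_ennreal average_le_superset T)
          (simp_all add: cube_props[OF Q(1)] grid_cell_props power_eq_top_ennreal del:
              emeasure_completion)
      also have "\<dots> = (6 ^ CARD('n)) ^ m * (\<Prod>i<m. average ?R (\<lambda>y. ennreal \<bar>f i y\<bar>))"
        by (simp add: prod.distrib)
      also have "\<dots> \<le> (6 ^ CARD('n)) ^ m * grid_product m (third_shift K T) K f x"
        unfolding grid_product_def by (intro mult_left_mono SUP_upper) auto
      also have "(6 ^ CARD('n)) ^ m = ennreal ((6 ^ CARD('n)) ^ m)"
        by (simp add: ennreal_power[symmetric])
      finally have "ennpow (?F Q) p \<le> ennpow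
          (ennreal ((6 ^ CARD('n)) ^ m) * grid_product m (third_shift K T) K f x) p"
        using assms by (intro ennpow_mono) auto
      also have "\<dots> = ennreal (((6 ^ CARD('n)) ^ m) powr p)
          * ennpow (grid_product m (third_shift K T) K f x) p"
        using assms by (simp add: ennpow_mult ennpow_pos)
      finally have "ennpow (?F Q) p * y \<le> ennreal (((6 ^ CARD('n)) ^ m) powr p)
          * (ennpow (grid_product m (third_shift K T) K f x) p * y)"
        by (simp add: mult_right_mono mult.assoc[symmetric])
      also have "\<dots> \<le> ?G K"
        by (rule member_le_sum) auto
      finally show ?thesis .
    qed
    then show "eventually (\<lambda>K. ennpow (?F Q) p * y \<le> ?G K) sequentially"
      by (auto simp: eventually_sequentially)
  qed
  finally show ?thesis .
qed

definition maximal_const :: "nat \<Rightarrow> nat \<Rightarrow> (nat \<Rightarrow> real) \<Rightarrow> real \<Rightarrow> real" where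
  "maximal_const n m P \<beta> = (let p = joint_exp m P in
     (2 ^ n * ((6 ^ n) ^ m) powr p *
       (doob_const (\<beta> * p) * (\<Prod>i<m. doob_const (P i) powr (p / P i)))) powr (1 / p))"

context multiple_weight
begin

lemma multi_maximal_bound:
  fixes f :: "nat \<Rightarrow> real ^ 'n \<Rightarrow> real"
  assumes f: "\<And>i. i < m \<Longrightarrow> f i \<in> borel_measurable lebesgue"
    and \<beta>: "\<And>i. i < m \<Longrightarrow> conj_exp (P i) / p \<le> \<beta>"
  shows "wnorm p v (multi_maximal m f) \<le> ennreal (maximal_const CARD('n) m P \<beta>) * ennpow A \<beta>
      * (\<Prod>i<m. Lnorm (P i) (w i) (f i))"
proof -
  define B where "B = doob_const (\<beta> * p) * (\<Prod>i<m. doob_const (P i) powr (p / P i))"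
  define c where "c = ((6 ^ CARD('n)) ^ m :: real) powr p"
  define N where "N i = (\<integral>\<^sup>+x. ennpow (ennreal \<bar>f i x\<bar>) (P i) * ennreal (w i x) \<partial>lebesgue)" for i
  have q: "\<beta> * p > 1" using \<beta> by (rule one_less_exponent)
  have \<beta>_pos: "\<beta> > 0" using q p_pos by (metis less_trans zero_less_one zero_less_mult_pos2)
  have "B > 0"
    unfolding B_def using q P doob_const_pos by (intro mult_pos_pos prod_pos) (auto simp: less_le)
  have "c > 0" by (simp add: c_def)
  note [measurable] = grid_product_measurable[OF f, of m]
  let ?D = "\<lambda>K T x. ennpow (grid_product m (third_shift K T) K f x) p * ennreal (v x)"
  have D_meas [measurable]: "?D K T \<in> borel_measurable lebesgue" for K T
    by measurable
  let ?bound = "ennpow A (\<beta> * p) * ennreal B * (\<Prod>i<m. ennpow (N i) (p / P i))"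
  have "(\<integral>\<^sup>+x. ennpow (multi_maximal m f x) p * ennreal (v x) \<partial>lebesgue)
      \<le> (\<integral>\<^sup>+x. liminf (\<lambda>K. \<Sum>T\<in>UNIV. ennreal c * ?D K T x) \<partial>lebesgue)"
    unfolding c_def by (intro nn_integral_mono multi_maximal_le_liminf_grid_products p_pos)
  also have "\<dots> \<le> liminf (\<lambda>K. \<integral>\<^sup>+x. (\<Sum>T\<in>UNIV. ennreal c * ?D K T x) \<partial>lebesgue)"
    by (intro nn_integral_liminf) measurable
  also have "\<dots> \<le> ennreal (2 ^ CARD('n) * c) * ?bound"
  proof (intro Liminf_le always_eventually allI)
    fix K
    have "(\<integral>\<^sup>+x. (\<Sum>T\<in>UNIV. ennreal c * ?D K T x) \<partial>lebesgue)
      = (\<Sum>T\<in>UNIV. ennreal c * (\<integral>\<^sup>+x. ?D K T x \<partial>lebesgue))"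
      by (simp add: nn_integral_sum nn_integral_cmult)
    also have "\<dots> \<le> (\<Sum>T\<in>(UNIV :: 'n set set). ennreal c * ?bound)"
      unfolding B_def N_def by (intro sum_mono mult_left_mono grid_product_bound f \<beta>) auto
    also have "\<dots> = ennreal (2 ^ CARD('n) * c) * ?bound"
      using \<open>c > 0\<close> by (simp add: card_UNIV_set ennreal_mult ennreal_power[symmetric] mult_ac)
    finally show "(\<integral>\<^sup>+x. (\<Sum>T\<in>UNIV. ennreal c * ?D K T x) \<partial>lebesgue)
        \<le> ennreal (2 ^ CARD('n) * c) * ?bound" .
  qed simp
  also have "\<dots> = ennreal (2 ^ CARD('n) * c * B) * ennpow A (\<beta> * p) * (\<Prod>i<m. ennpow (N i) (p / P i))"
    using \<open>c > 0\<close> \<open>B > 0\<close> by (simp add: ennreal_mult mult_ac)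
  finally have "wnorm p v (multi_maximal m f)
      \<le> ennpow (ennreal (2 ^ CARD('n) * c * B) * ennpow A (\<beta> * p) * (\<Prod>i<m. ennpow (N i) (p / P i)))
          (1 / p)"
    unfolding wnorm_def using p_pos by (intro ennpow_mono) auto
  also have "\<dots> = ennpow (ennreal (2 ^ CARD('n) * c * B)) (1 / p) * ennpow (ennpow A (\<beta> * p)) (1 / p)
       * (\<Prod>i<m. ennpow (ennpow (N i) (p / P i)) (1 / p))"
    using p_pos by (simp add: ennpow_mult ennpow_prod)
  also have "ennpow (ennreal (2 ^ CARD('n) * c * B)) (1 / p) = ennreal (maximal_const CARD('n) m P \<beta>)"
    using \<open>c > 0\<close> \<open>B > 0\<close> by (simp add: ennpow_pos maximal_const_def Let_def c_def B_def mult.assoc)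
  also have "ennpow (ennpow A (\<beta> * p)) (1 / p) = ennpow A \<beta>"
    using p_pos \<beta>_pos by (simp add: ennpow_ennpow)
  also have "(\<Prod>i<m. ennpow (ennpow (N i) (p / P i)) (1 / p)) = (\<Prod>i<m. Lnorm (P i) (w i) (f i))"
  proof (intro prod.cong refl)
    fix i assume "i \<in> {..<m}"
    then show "ennpow (ennpow (N i) (p / P i)) (1 / p) = Lnorm (P i) (w i) (f i)"
      using P[of i] p_pos by (simp add: ennpow_ennpow wnorm_def N_def)
  qed
  finally show ?thesis .
qed

end

section \<open>Power weights and sharpness\<close>

lemma nn_integral_reflect:
  fixes g :: "real \<Rightarrow> ennreal"
  assumes "g \<in> borel_measurable borel"
  shows "(\<integral>\<^sup>+t. g (- t) \<partial>lborel) = (\<integral>\<^sup>+t. g t \<partial>lborel)"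
  using nn_integral_real_affine[OF assms, of "-1" 0] by simp

lemma nn_integral_powr_Icc:
  assumes "r > -1" "t \<ge> 0"
  shows "(\<integral>\<^sup>+s. ennreal (\<bar>s\<bar> powr r) * indicator {0..t} s \<partial>lborel)
      = ennreal (t powr (r + 1) / (r + 1))"
proof -
  have "(\<integral>\<^sup>+s. ennreal (\<bar>s\<bar> powr r) * indicator {0..t} s \<partial>lborel)
      = (\<integral>\<^sup>+s. ennreal (indicator {0..t} s * s powr r) \<partial>lborel)"
    by (intro nn_integral_cong) (auto simp: indicator_def)
  also have "\<dots> = ennreal (t powr (r + 1) / (r + 1))"
    by (intro nn_integral_has_integral_lebesgue has_integral_powr_from_0 assms) simp
  finally show ?thesis .
qed

text \<open>The average of the singular power over an interval is at most \<open>2 / e\<close> times its value at the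
  end farthest from the singularity. An interval that stays away from \<open>0\<close> compared to its length
  sees a nearly constant function; any other one is comparable to an interval around or ending at
  \<open>0\<close>.\<close>

lemma nn_integral_abs_powr_le_right:
  fixes a b e :: real
  assumes e: "0 < e" "e \<le> 1" and ab: "a < b" "\<bar>a\<bar> \<le> b"
  shows "(\<integral>\<^sup>+s. ennreal (\<bar>s\<bar> powr (e - 1)) * indicator {a..b} s \<partial>lborel)
      \<le> ennreal (2 / e * b powr (e - 1) * (b - a))"
proof -
  have b: "b > 0" using ab by linarith
  have from_0: "(\<integral>\<^sup>+s. ennreal (\<bar>s\<bar> powr (e - 1)) * indicator {0..b} s \<partial>lborel)
      = ennreal (b powr e / e)"
    using nn_integral_powr_Icc[of "e - 1" b] e b by simp
  have b_powr: "b powr e = b powr (e - 1) * b" using b by (simp add: powr_diff)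
  consider "a \<ge> b / 2" | "0 \<le> a" "a < b / 2" | "a < 0" by linarith
  then show ?thesis
  proof cases
    case 1
    have "(\<integral>\<^sup>+s. ennreal (\<bar>s\<bar> powr (e - 1)) * indicator {a..b} s \<partial>lborel)
      \<le> (\<integral>\<^sup>+s. ennreal (2 / e * b powr (e - 1)) * indicator {a..b} s \<partial>lborel)"
    proof (rule nn_integral_mono)
      fix s :: real
      show "ennreal (\<bar>s\<bar> powr (e - 1)) * indicator {a..b} s
          \<le> ennreal (2 / e * b powr (e - 1)) * indicator {a..b} s"
      proof (cases "s \<in> {a..b}")
        case True
        then have "s powr (e - 1) \<le> (b / 2) powr (e - 1)"
          using 1 b e by (intro powr_mono2') auto
        also have "\<dots> = 2 powr (1 - e) * b powr (e - 1)"
          using b by (simp add: powr_divide powr_diff)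
        also have "2 powr (1 - e) \<le> 2 powr 1" using e by (intro powr_mono) auto
        also have "2 powr 1 \<le> 2 / e" using e by (simp add: field_simps)
        finally have "s powr (e - 1) \<le> 2 / e * b powr (e - 1)" by (simp add: mult_right_mono)
        then show ?thesis using True 1 b by (auto intro!: ennreal_leI)
      qed simp
    qed
    also have "\<dots> = ennreal (2 / e * b powr (e - 1) * (b - a))"
      using ab e by (simp add: nn_integral_cmult_indicator ennreal_mult[symmetric])
    finally show ?thesis .
  next
    case 2
    have "(\<integral>\<^sup>+s. ennreal (\<bar>s\<bar> powr (e - 1)) * indicator {a..b} s \<partial>lborel) \<le> ennreal (b powr e / e)"
      unfolding from_0[symmetric] using 2
          by (intro nn_integral_mono mult_left_mono) (auto simp: indicator_def)
    also have "\<dots> \<le> ennreal (2 / e * b powr (e - 1) * (b - a))"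
    proof (rule ennreal_leI)
      have "b powr e / e = (b powr (e - 1) / e) * b" by (simp add: b_powr)
      also have "\<dots> \<le> (b powr (e - 1) / e) * (2 * (b - a))"
        using 2 e by (intro mult_left_mono) auto
      also have "\<dots> = 2 / e * b powr (e - 1) * (b - a)" by (simp add: mult_ac)
      finally show "b powr e / e \<le> 2 / e * b powr (e - 1) * (b - a)" .
    qed
    finally show ?thesis .
  next
    case 3
    have "(\<integral>\<^sup>+s. ennreal (\<bar>s\<bar> powr (e - 1)) * indicator {a..b} s \<partial>lborel)
      \<le> (\<integral>\<^sup>+s. (ennreal (\<bar>s\<bar> powr (e - 1)) * indicator {0..b} s + ennreal (\<bar>- s\<bar> powr (e - 1))
          * indicator {0..b} (- s)) \<partial>lborel)"
      using ab by (intro nn_integral_mono) (auto simp: indicator_def)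
    also have "\<dots> = (\<integral>\<^sup>+s. ennreal (\<bar>s\<bar> powr (e - 1)) * indicator {0..b} s \<partial>lborel)
       + (\<integral>\<^sup>+s. ennreal (\<bar>- s\<bar> powr (e - 1)) * indicator {0..b} (- s) \<partial>lborel)"
      by (intro nn_integral_add) measurable
    also have "(\<integral>\<^sup>+s. ennreal (\<bar>- s\<bar> powr (e - 1)) * indicator {0..b} (- s) \<partial>lborel)
       = (\<integral>\<^sup>+s. ennreal (\<bar>s\<bar> powr (e - 1)) * indicator {0..b} s \<partial>lborel)"
      by (rule nn_integral_reflect) measurable
    also have "\<dots> + \<dots> = ennreal (2 * (b powr e / e))"
      unfolding from_0 using e by (subst ennreal_plus[symmetric]) auto
    also have "\<dots> \<le> ennreal (2 / e * b powr (e - 1) * (b - a))"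
    proof (rule ennreal_leI)
      have "2 * (b powr e / e) = (2 / e * b powr (e - 1)) * b" by (simp add: b_powr)
      also have "\<dots> \<le> (2 / e * b powr (e - 1)) * (b - a)"
        using 3 e by (intro mult_left_mono) auto
      finally show "2 * (b powr e / e) \<le> 2 / e * b powr (e - 1) * (b - a)" .
    qed
    finally show ?thesis .
  qed
qed

lemma nn_integral_abs_powr_le:
  fixes a b e :: real
  assumes e: "0 < e" "e \<le> 1" and ab: "a < b"
  shows "(\<integral>\<^sup>+s. ennreal (\<bar>s\<bar> powr (e - 1)) * indicator {a..b} s \<partial>lborel)
     \<le> ennreal (2 / e * (max \<bar>a\<bar> \<bar>b\<bar>) powr (e - 1) * (b - a))"
proof (cases "\<bar>a\<bar> \<le> b")
  case True
  then show ?thesis using nn_integral_abs_powr_le_right[OF e ab True] by (simp add: max_absorb2)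
next
  case False
  then have "\<bar>- b\<bar> \<le> - a" "max \<bar>a\<bar> \<bar>b\<bar> = - a" using ab by auto
  moreover have "(\<integral>\<^sup>+s. ennreal (\<bar>s\<bar> powr (e - 1)) * indicator {a..b} s \<partial>lborel)
     = (\<integral>\<^sup>+s. ennreal (\<bar>- s\<bar> powr (e - 1)) * indicator {a..b} (- s) \<partial>lborel)"
    by (rule nn_integral_reflect[symmetric]) measurable
  moreover have "\<dots> = (\<integral>\<^sup>+s. ennreal (\<bar>s\<bar> powr (e - 1)) * indicator {- b..- a} s \<partial>lborel)"
    by (intro nn_integral_cong) (auto simp: indicator_def)
  ultimately show ?thesis
    using nn_integral_abs_powr_le_right[OF e, of "- b" "- a"] ab by (simp add: add.commute)
qed

lemma prod_Basis_cart:
  fixes F :: "real ^ 'n \<Rightarrow> 'b :: comm_monoid_mult"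
  shows "(\<Prod>b\<in>Basis. F b) = (\<Prod>i\<in>UNIV. F (axis i 1))"
proof -
  have "(Basis :: (real ^ 'n) set) = (\<lambda>i. axis i 1) ` UNIV" by (auto simp: Basis_vec_def)
  moreover have "inj (\<lambda>i :: 'n. axis i (1::real))" by (auto simp: inj_on_def axis_eq_axis)
  ultimately show ?thesis by (metis (no_types, lifting) prod.reindex_cong)
qed

text \<open>Averages over cubes of functions of a single coordinate reduce to averages over intervals,
  so the examples can be computed in dimension one.\<close>

lemma average_cylinder:
  fixes a b :: "real ^ 'n"
  assumes l: "l > 0" "\<And>i. b $ i - a $ i = l" and [measurable]: "g \<in> borel_measurable borel"
  shows "average (cbox a b) (\<lambda>x. g (x $ k)) = (\<integral>\<^sup>+t. g t * indicator {a $ k..b $ k} t \<partial>lborel)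
      / ennreal l"
proof -
  define F :: "real ^ 'n \<Rightarrow> real \<Rightarrow> ennreal" where
    "F u t = (if u = axis k 1 then g t else 1) * indicator {a \<bullet> u..b \<bullet> u} t" for u t
  have F_meas: "F u \<in> borel_measurable borel" for u unfolding F_def by measurable
  have "(\<integral>\<^sup>+x. g (x $ k) * indicator (cbox a b) x \<partial>lebesgue)
      = (\<integral>\<^sup>+x. (\<Prod>u\<in>Basis. F u (x \<bullet> u)) \<partial>lborel)"
    unfolding nn_integral_completion
  proof (intro nn_integral_cong)
    fix x :: "real ^ 'n"
    have "(\<Prod>u\<in>Basis. F u (x \<bullet> u)) = (\<Prod>i\<in>UNIV. (if i = k then g (x $ i) else 1))
        * (\<Prod>i\<in>UNIV. indicator {a $ i..b $ i} (x $ i))"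
      unfolding prod_Basis_cart prod.distrib[symmetric]
      by (intro prod.cong) (auto simp: F_def inner_axis axis_eq_axis)
    also have "(\<Prod>i\<in>UNIV. (if i = k then g (x $ i) else 1)) = g (x $ k)"
      by (simp add: prod.delta)
    also have "(\<Prod>i\<in>UNIV. indicator {a $ i..b $ i} (x $ i)) = (indicator (cbox a b) x :: ennreal)"
      by (auto simp: indicator_def mem_box_cart)
    finally show "g (x $ k) * indicator (cbox a b) x = (\<Prod>u\<in>Basis. F u (x \<bullet> u))" ..
  qed
  also have "\<dots> = (\<Prod>u\<in>Basis. (\<integral>\<^sup>+t. F u t \<partial>lborel))"
    by (intro nn_integral_lborel_prod F_meas) simp
  also have "\<dots>
      = (\<Prod>i\<in>UNIV. if i = k then (\<integral>\<^sup>+t. g t * indicator {a $ k..b $ k} t \<partial>lborel) else ennreal l)"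
    unfolding prod_Basis_cart
  proof (intro prod.cong refl)
    fix i :: 'n
    have "a $ i \<le> b $ i" using l(1) l(2)[of i] by linarith
    then show "(\<integral>\<^sup>+t. F (axis i 1) t \<partial>lborel)
        = (if i = k then (\<integral>\<^sup>+t. g t * indicator {a $ k..b $ k} t \<partial>lborel) else ennreal l)"
      by (auto simp: F_def inner_axis axis_eq_axis l(2))
  qed
  also have "\<dots> = (\<integral>\<^sup>+t. g t * indicator {a $ k..b $ k} t \<partial>lborel) * ennreal l ^ (CARD('n) - 1)"
    by (subst prod.remove[of _ k]) (simp_all add: card_Diff_singleton)
  finally have I: "(\<integral>\<^sup>+x. g (x $ k) * indicator (cbox a b) x \<partial>lebesgue)
    = (\<integral>\<^sup>+t. g t * indicator {a $ k..b $ k} t \<partial>lborel) * ennreal l ^ (CARD('n) - 1)" .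
  have "ennreal (l ^ CARD('n)) = ennreal l * ennreal l ^ (CARD('n) - 1)"
    using l(1) by (simp add: ennreal_power power_Suc[symmetric] flip: ennreal_power)
  moreover have "X * L / (ennreal l * L) = X / ennreal l" if "L \<noteq> 0" "L \<noteq> top" for X L :: ennreal
  proof -
    have "inverse (ennreal l * L) = inverse (ennreal l) * inverse L"
      using that l(1) by (intro ennreal_inverse_mult') (auto simp: less_top zero_less_iff_neq_zero)
    moreover have "L * inverse L = 1"
      using that by (metis divide_ennreal_def ennreal_divide_self less_top zero_less_iff_neq_zero)
    ultimately show ?thesis by (simp add: divide_ennreal_def)
        (metis mult.left_commute mult.right_neutral)
  qed
  ultimately show ?thesis
    unfolding average_def I emeasure_lebesgue_cube[OF l]
    using l(1) by (simp add: ennreal_power power_eq_top_ennreal power_eq_0_iff)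
qed


lemma component_measurable [measurable]: "(\<lambda>x :: real ^ 'n. x $ k) \<in> borel_measurable lebesgue"
  by (intro measurable_completion) (simp add: borel_measurable_continuous_onI continuous_intros)

text \<open>The extremal example. The weight at the index \<open>i0\<close> is a power of one coordinate whose dual
  weight \<open>\<bar>x\<^sub>k\<bar>\<close> to the power \<open>e - 1\<close> is barely integrable, and all other weights are trivial. The
  functions are singular in the same coordinate: \<open>spike i0\<close> is the dual weight on the unit cube,
  and the other exponents make \<open>\<bar>spike i\<bar>\<close> to the power \<open>p\<^sub>i\<close> times the weight the same function
  for all \<open>i\<close>.\<close>

locale power_weight_example =
  fixes m :: nat and P :: "nat \<Rightarrow> real" and i0 :: nat and e :: real and k :: "'n :: finite"
  assumes P: "\<And>i. i < m \<Longrightarrow> 1 < P i" and i0: "i0 < m" and e: "0 < e" "e < 1"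
begin

abbreviation p :: real where "p \<equiv> joint_exp m P"

definition spike_weight :: "nat \<Rightarrow> real ^ 'n \<Rightarrow> real" where
  "spike_weight i x = (if i = i0 then \<bar>x $ k\<bar> powr ((1 - e) * (P i0 - 1)) else 1)"

definition spike_exp :: "nat \<Rightarrow> real" where
  "spike_exp i = (if i = i0 then e - 1 else (e - 1) / P i)"

definition spike :: "nat \<Rightarrow> real ^ 'n \<Rightarrow> real" where
  "spike i x = indicator (cbox 0 1) x * \<bar>x $ k\<bar> powr spike_exp i"

lemma p_pos: "p > 0"
  using i0 P by (intro joint_exp_pos) auto

lemma spike_exp_bounds: "i < m \<Longrightarrow> - 1 < spike_exp i" "i < m \<Longrightarrow> spike_exp i \<le> 0"
  using P[of i] e by (auto simp: spike_exp_def field_simps)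

lemma joint_spike_weight: "joint_weight m P spike_weight x
    = \<bar>x $ k\<bar> powr ((1 - e) * (p / conj_exp (P i0)))"
proof -
  have "joint_weight m P spike_weight x = (\<Prod>i<m. if i
      = i0 then \<bar>x $ k\<bar> powr ((1 - e) * (P i0 - 1) * (p / P i0)) else 1)"
    unfolding joint_weight_def by (intro prod.cong) (auto simp: spike_weight_def powr_powr)
  also have "\<dots> = \<bar>x $ k\<bar> powr ((1 - e) * (P i0 - 1) * (p / P i0))"
    using i0 by (simp add: prod.delta)
  also have "(1 - e) * (P i0 - 1) * (p / P i0) = (1 - e) * (p / conj_exp (P i0))"
    using P[OF i0] by (simp add: conj_exp_def field_simps)
  finally show ?thesis .
qed

lemma dual_spike_weight: "spike_weight i0 x powr (1 - conj_exp (P i0)) = \<bar>x $ k\<bar> powr (e - 1)"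
proof -
  have "(1 - e) * (P i0 - 1) * (1 - conj_exp (P i0)) = e - 1"
    using P[OF i0] by (simp add: conj_exp_def field_simps)
  then show ?thesis by (simp add: spike_weight_def powr_powr)
qed

text \<open>With \<open>R\<close> the largest absolute value of the singular coordinate on a cube, both the average
  of \<open>v\<close> and that of the dual weight are bounded by powers of \<open>R\<close>, which cancel in the product. So
  the bound is uniform in the cube.\<close>

lemma AP_const_spike_weight_le: "AP_const m P spike_weight
    \<le> ennreal ((2 / e) powr (p / conj_exp (P i0)))"
  unfolding AP_const_def
proof (rule SUP_least)
  fix Q :: "(real ^ 'n) set" assume "Q \<in> cubes"
  then obtain a b l where Q: "Q = cbox a b" "l > 0" "\<And>i. b $ i - a $ i = l"
    by (auto simp: cubes_def)
  define \<delta> where "\<delta> = p / conj_exp (P i0)"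
  have \<delta>: "\<delta> > 0" using p_pos P[OF i0] by (simp add: \<delta>_def conj_exp_def)
  define R where "R = max \<bar>a $ k\<bar> \<bar>b $ k\<bar>"
  have ab: "a $ k < b $ k" using Q(2) Q(3)[of k] by linarith
  then have R: "R > 0" by (auto simp: R_def)
  have const: "average Q (\<lambda>x. c) = c" for c
    using average_cylinder[OF Q(2,3), of "\<lambda>_. c" k] Q(2) ab Q(3)[of k]
    by (simp add: Q(1) nn_integral_cmult_indicator ennreal_times_divide[symmetric] less_imp_le
        ennreal_divide_self)
  have "average Q (\<lambda>x. ennreal (joint_weight m P spike_weight x))
      \<le> average Q (\<lambda>x. ennreal (R powr ((1 - e) * \<delta>)))"
  proof (rule average_mono)
    fix x assume "x \<in> Q"
    then have "a $ k \<le> x $ k" "x $ k \<le> b $ k" by (auto simp: Q(1) mem_box_cart)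
    then have "\<bar>x $ k\<bar> \<le> R" by (auto simp: R_def)
    then show "ennreal (joint_weight m P spike_weight x) \<le> ennreal (R powr ((1 - e) * \<delta>))"
      unfolding joint_spike_weight \<delta>_def[symmetric] using e \<delta>
      by (intro ennreal_leI powr_mono2) auto
  qed
  then have v_le: "average Q (\<lambda>x. ennreal (joint_weight m P spike_weight x))
      \<le> ennreal (R powr ((1 - e) * \<delta>))"
    by (simp add: const)
  have "average Q (\<lambda>x. ennreal (spike_weight i0 x powr (1 - conj_exp (P i0))))
     = (\<integral>\<^sup>+t. ennreal (\<bar>t\<bar> powr (e - 1)) * indicator {a $ k..b $ k} t \<partial>lborel) / ennreal l"
    unfolding dual_spike_weight Q(1) by (intro average_cylinder Q(2,3)) measurable
  also have "\<dots> \<le> ennreal (2 / e * R powr (e - 1) * (b $ k - a $ k)) / ennreal l"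
    unfolding R_def using e ab by (intro divide_right_mono_ennreal nn_integral_abs_powr_le) auto
  also have "\<dots> = ennreal (2 / e * R powr (e - 1))"
    using Q(2) e by (simp add: Q(3) divide_ennreal)
  finally have \<sigma>_le: "average Q (\<lambda>x. ennreal (spike_weight i0 x powr (1 - conj_exp (P i0))))
      \<le> ennreal (2 / e * R powr (e - 1))" .
  have "(\<Prod>i<m. ennpow (average Q (\<lambda>x. ennreal (spike_weight i x powr (1 - conj_exp (P i)))))
      (p / conj_exp (P i)))
     = (\<Prod>i<m. if i = i0 then ennpow (average Q
         (\<lambda>x. ennreal (spike_weight i0 x powr (1 - conj_exp (P i0))))) \<delta> else 1)"
    by (intro prod.cong) (auto simp: spike_weight_def \<delta>_def const)
  also have "\<dots> = ennpow (average Q (\<lambda>x. ennreal (spike_weight i0 x powr (1 - conj_exp (P i0))))) \<delta>"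
    using i0 by (simp add: prod.delta)
  also have "\<dots> \<le> ennpow (ennreal (2 / e * R powr (e - 1))) \<delta>"
    using \<delta> by (intro ennpow_mono \<sigma>_le) auto
  also have "\<dots> = ennreal ((2 / e) powr \<delta> * R powr ((e - 1) * \<delta>))"
    using e R by (simp add: ennpow_pos powr_mult powr_powr powr_divide)
  finally have "average Q (\<lambda>x. ennreal (joint_weight m P spike_weight x)) *
      (\<Prod>i<m. ennpow (average Q (\<lambda>x. ennreal (spike_weight i x powr (1 - conj_exp (P i)))))
          (p / conj_exp (P i)))
    \<le> ennreal (R powr ((1 - e) * \<delta>)) * ennreal ((2 / e) powr \<delta> * R powr ((e - 1) * \<delta>))"
    by (intro mult_mono v_le) auto
  also have "\<dots> = ennreal ((2 / e) powr \<delta>)"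
  proof -
    have "R powr ((1 - e) * \<delta>) * R powr ((e - 1) * \<delta>) = 1"
      using R by (simp add: powr_add[symmetric] algebra_simps)
    then have "R powr ((1 - e) * \<delta>) * ((2 / e) powr \<delta> * R powr ((e - 1) * \<delta>)) = (2 / e) powr \<delta>"
      by (simp add: mult.left_commute)
    then show ?thesis by (simp add: ennreal_mult[symmetric])
  qed
  finally show "average Q (\<lambda>x. ennreal (joint_weight m P spike_weight x)) *
      (\<Prod>i<m. ennpow (average Q (\<lambda>x. ennreal (spike_weight i x powr (1 - conj_exp (P i)))))
          (p / conj_exp (P i)))
    \<le> ennreal ((2 / e) powr (p / conj_exp (P i0)))"
    unfolding \<delta>_def .
qed

lemma spike_weight_AP: "spike_weight \<in> AP m P"
proof -
  have "negligible {x :: real ^ 'n. x $ k = 0}" by (rule negligible_standard_hyperplane_cart)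
  then have "AE x in lebesgue. x \<notin> {x :: real ^ 'n. x $ k = 0}"
    by (metis negligible_iff_null_sets AE_not_in)
  then have "AE x in lebesgue. 0 < spike_weight i x" for i
    by eventually_elim (auto simp: spike_weight_def)
  moreover have "spike_weight i \<in> borel_measurable lebesgue" for i
    unfolding spike_weight_def by (cases "i = i0") (simp_all, measurable)
  moreover have "AP_const m P spike_weight < \<infinity>"
    using AP_const_spike_weight_le by (rule le_less_trans) simp
  ultimately show ?thesis by (auto simp: AP_def weight_def)
qed

lemma integral_unit_cube:
  assumes "s > - 1"
  shows "(\<integral>\<^sup>+x. ennreal (\<bar>x $ k\<bar> powr s) * indicator (cbox 0 (1 :: real ^ 'n)) x \<partial>lebesgue)
      = ennreal (1 / (s + 1))"
proof -
  have "emeasure lebesgue (cbox 0 (1 :: real ^ 'n)) = 1"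
    using emeasure_lebesgue_cube[of 1 "1 :: real ^ 'n" 0] by simp
  then have "(\<integral>\<^sup>+x. ennreal (\<bar>x $ k\<bar> powr s) * indicator (cbox 0 (1 :: real ^ 'n)) x \<partial>lebesgue)
     = average (cbox 0 (1 :: real ^ 'n)) (\<lambda>x. ennreal (\<bar>x $ k\<bar> powr s))"
    by (simp add: average_def divide_ennreal_def del: emeasure_completion)
  also have "\<dots> = (\<integral>\<^sup>+t. ennreal (\<bar>t\<bar> powr s) * indicator {0..1} t \<partial>lborel) / ennreal 1"
    using average_cylinder[of 1 "1 :: real ^ 'n" 0 "\<lambda>t. ennreal (\<bar>t\<bar> powr s)" k] by simp
  also have "\<dots> = ennreal (1 / (s + 1))"
    using nn_integral_powr_Icc[of s 1] assms by (simp add: divide_ennreal_def)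
  finally show ?thesis .
qed

lemma Lnorm_spike:
  assumes "i < m"
  shows "Lnorm (P i) (spike_weight i) (spike i) = ennpow (ennreal (1 / e)) (1 / P i)"
proof -
  have P': "P i > 1" by (rule P[OF assms])
  have exponent: "spike_exp i * P i + (if i = i0 then (1 - e) * (P i0 - 1) else 0) = e - 1"
    using P' by (cases "i = i0") (simp_all add: spike_exp_def, simp add: algebra_simps)
  have "(\<integral>\<^sup>+x. ennpow (ennreal \<bar>spike i x\<bar>) (P i) * ennreal (spike_weight i x) \<partial>lebesgue)
     = (\<integral>\<^sup>+x. ennreal (\<bar>x $ k\<bar> powr (e - 1)) * indicator (cbox 0 1) x \<partial>lebesgue)"
  proof (intro nn_integral_cong)
    fix x :: "real ^ 'n"
    have "(\<bar>x $ k\<bar> powr spike_exp i) powr P i * spike_weight i x = \<bar>x $ k\<bar> powr (e - 1)"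
      unfolding exponent[symmetric] powr_add by (simp add: spike_weight_def powr_powr)
    then show "ennpow (ennreal \<bar>spike i x\<bar>) (P i) * ennreal (spike_weight i x)
        = ennreal (\<bar>x $ k\<bar> powr (e - 1)) * indicator (cbox 0 1) x"
      using P' by (simp add: spike_def indicator_def ennpow_nonneg ennreal_mult'[symmetric])
  qed
  then show ?thesis using e integral_unit_cube[of "e - 1"] by (simp add: wnorm_def)
qed

lemma spike_measurable: "spike i \<in> borel_measurable lebesgue"
  unfolding spike_def by (intro borel_measurable_times borel_measurable_indicator) (simp, measurable)

lemma spike_Lspace: "i < m \<Longrightarrow> spike i \<in> Lspace (P i) (spike_weight i)"
  using e by (simp add: Lspace_def spike_measurable Lnorm_spike ennpow_pos)

lemma prod_Lnorm_spike: "(\<Prod>i<m. Lnorm (P i) (spike_weight i) (spike i))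
    = ennreal ((1 / e) powr (1 / p))"
proof -
  have "(\<Prod>i<m. Lnorm (P i) (spike_weight i) (spike i)) = (\<Prod>i<m. ennreal ((1 / e) powr (1 / P i)))"
    using e by (intro prod.cong) (auto simp: Lnorm_spike ennpow_pos)
  also have "\<dots> = ennreal ((1 / e) powr (\<Sum>i<m. 1 / P i))"
    using e by (simp add: prod_ennreal powr_sum)
  finally show ?thesis by (simp add: joint_exp_def)
qed

text \<open>It suffices to test the cube of side \<open>x\<^sub>k\<close> that touches the singular hyperplane, contains
  \<open>x\<close> and stays in the unit cube. Only the function at \<open>i0\<close> gains the factor \<open>1 / e\<close>.\<close>

lemma maximal_ge:
  assumes x: "x \<in> cbox 0 1" "x $ k > 0"
  shows "multi_maximal m spike x \<ge> ennreal (1 / e * \<bar>x $ k\<bar> powr (\<Sum>i<m. spike_exp i))"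
proof -
  define t where "t = x $ k"
  have t: "0 < t" "t \<le> 1" using x by (auto simp: t_def mem_box_cart)
  define a :: "real ^ 'n" where "a = (\<chi> i. max 0 (x $ i - t))"
  define b :: "real ^ 'n" where "b = (\<chi> i. a $ i + t)"
  have ba: "b $ i - a $ i = t" for i by (simp add: b_def)
  have cube: "cbox a b \<in> cubes" unfolding cubes_def using ba t by blast
  have x01: "0 \<le> x $ i" "x $ i \<le> 1" for i using x by (auto simp: mem_box_cart)
  have mem: "x \<in> cbox a b"
    using x01 t by (auto simp: mem_box_cart a_def b_def)
  have sub: "cbox a b \<subseteq> cbox 0 1"
  proof
    fix y assume y: "y \<in> cbox a b"
    show "y \<in> cbox 0 1"
      unfolding mem_box_cart
    proof
      fix i
      have "a $ i \<le> y $ i" "y $ i \<le> b $ i" using y by (auto simp: mem_box_cart)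
      then show "(0 :: real ^ 'n) $ i \<le> y $ i \<and> y $ i \<le> (1 :: real ^ 'n) $ i"
        using x01[of i] t by (auto simp: a_def b_def)
    qed
  qed
  have avg: "average (cbox a b) (\<lambda>y. ennreal \<bar>spike i y\<bar>)
      = ennreal (t powr spike_exp i / (spike_exp i + 1))" if i: "i < m" for i
  proof -
    have "average (cbox a b) (\<lambda>y. ennreal \<bar>spike i y\<bar>)
        = average (cbox a b) (\<lambda>y. ennreal (\<bar>y $ k\<bar> powr spike_exp i))"
      using sub by (intro antisym average_mono) (auto simp: spike_def indicator_def)
    also have "\<dots> = (\<integral>\<^sup>+s. ennreal (\<bar>s\<bar> powr spike_exp i) * indicator {a $ k..b $ k} s \<partial>lborel)
        / ennreal t"
      using t ba by (intro average_cylinder) auto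
    also have "a $ k = 0" by (simp add: a_def t_def)
    also have "b $ k = t" by (simp add: b_def a_def t_def)
    also have "(\<integral>\<^sup>+s. ennreal (\<bar>s\<bar> powr spike_exp i) * indicator {0..t} s \<partial>lborel)
        = ennreal (t powr (spike_exp i + 1) / (spike_exp i + 1))"
      using t spike_exp_bounds[OF i] by (intro nn_integral_powr_Icc) auto
    also have "\<dots> / ennreal t = ennreal (t powr spike_exp i / (spike_exp i + 1))"
      using t spike_exp_bounds[OF i] by (simp add: divide_ennreal powr_add)
    finally show ?thesis .
  qed
  have "(\<Prod>i<m. t powr spike_exp i * (if i = i0 then 1 / e else 1))
      \<le> (\<Prod>i<m. t powr spike_exp i / (spike_exp i + 1))"
  proof (intro prod_mono conjI)
    fix i assume "i \<in> {..<m}"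
    then have "1 \<le> 1 / (spike_exp i + 1)" using spike_exp_bounds[of i] by (simp add: field_simps)
    then have "(if i = i0 then 1 / e else 1) \<le> 1 / (spike_exp i + 1)"
      by (cases "i = i0") (simp_all add: spike_exp_def[of i0])
    then show "t powr spike_exp i * (if i = i0 then 1 / e else 1)
        \<le> t powr spike_exp i / (spike_exp i + 1)"
      using mult_left_mono[of _ _ "t powr spike_exp i"] by fastforce
  qed (use e in auto)
  also have "(\<Prod>i<m. t powr spike_exp i * (if i = i0 then 1 / e else 1))
      = 1 / e * t powr (\<Sum>i<m. spike_exp i)"
    using i0 t by (simp add: prod.distrib prod.delta powr_sum)
  finally have "ennreal (1 / e * t powr (\<Sum>i<m. spike_exp i))
      \<le> ennreal (\<Prod>i<m. t powr spike_exp i / (spike_exp i + 1))"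
    by (rule ennreal_leI)
  also have "\<dots> = (\<Prod>i<m. average (cbox a b) (\<lambda>y. ennreal \<bar>spike i y\<bar>))"
  proof -
    have "0 \<le> t powr spike_exp i / (spike_exp i + 1)" if "i < m" for i
      using spike_exp_bounds(1)[OF that] by simp
    then show ?thesis by (subst prod_ennreal[symmetric]) (auto simp: avg)
  qed
  also have "\<dots> \<le> multi_maximal m spike x"
    unfolding multi_maximal_def using cube mem by (intro SUP_upper) auto
  finally show ?thesis using t by (simp add: t_def)
qed

text \<open>The exponents balance once more: the power \<open>p\<close> of the lower bound times \<open>v\<close> is a multiple of
  \<open>\<bar>x\<^sub>k\<bar>\<close> to the power \<open>e - 1\<close>, the integrand of all the norms on the right-hand side. Thus the
  integrals match, and the gain \<open>1 / e\<close> is left.\<close>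

lemma wnorm_maximal_ge:
  "wnorm p (joint_weight m P spike_weight) (multi_maximal m spike) \<ge> ennreal
      (1 / e * (1 / e) powr (1 / p))"
proof -
  have sum_spike_exp: "(\<Sum>i<m. spike_exp i) = (e - 1) * (1 + 1 / p - 1 / P i0)"
  proof -
    have "(\<Sum>i<m. spike_exp i) = spike_exp i0 + (\<Sum>i\<in>{..<m} - {i0}. spike_exp i)" using i0
        by (intro sum.remove) auto
    also have "(\<Sum>i\<in>{..<m} - {i0}. spike_exp i) = (\<Sum>i\<in>{..<m} - {i0}. (e - 1) * (1 / P i))"
      by (intro sum.cong) (auto simp: spike_exp_def)
    also have "\<dots> = (e - 1) * ((\<Sum>i<m. 1 / P i) - 1 / P i0)"
      unfolding sum_distrib_left[symmetric] using i0 by (subst sum_diff1) auto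
    also have "(\<Sum>i<m. 1 / P i) = 1 / p" by (simp add: joint_exp_def)
    finally show ?thesis by (simp add: spike_exp_def algebra_simps)
  qed
  have exponent: "(\<Sum>i<m. spike_exp i) * p + (1 - e) * (p / conj_exp (P i0)) = e - 1"
  proof -
    have conj: "p / conj_exp (P i0) = p - p / P i0"
      using P[OF i0] by (simp add: conj_exp_def field_simps)
    show ?thesis
      unfolding sum_spike_exp conj using p_pos P[OF i0] by (simp add: field_simps)
  qed
  have "ennreal ((1 / e) powr p * (1 / e)) = ennreal ((1 / e) powr p) *
      (\<integral>\<^sup>+x. ennreal (\<bar>x $ k\<bar> powr (e - 1)) * indicator (cbox 0 (1 :: real ^ 'n)) x \<partial>lebesgue)"
    using e integral_unit_cube[of "e - 1"] ennreal_mult[of "(1 / e) powr p" "1 / e"] by simp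
  also have "\<dots> = (\<integral>\<^sup>+x. ennreal ((1 / e) powr p)
      * (ennreal (\<bar>x $ k\<bar> powr (e - 1)) * indicator (cbox 0 (1 :: real ^ 'n)) x) \<partial>lebesgue)"
    by (intro nn_integral_cmult[symmetric] borel_measurable_times_ennreal borel_measurable_indicator)
        (measurable, simp)
  also have "\<dots> \<le> (\<integral>\<^sup>+x. ennpow (multi_maximal m spike x) p
      * ennreal (joint_weight m P spike_weight x) \<partial>lebesgue)"
  proof (intro nn_integral_mono)
    fix x :: "real ^ 'n"
    show "ennreal ((1 / e) powr p) * (ennreal (\<bar>x $ k\<bar> powr (e - 1)) * indicator (cbox 0 1) x)
      \<le> ennpow (multi_maximal m spike x) p * ennreal (joint_weight m P spike_weight x)"
    proof (cases "x \<in> cbox 0 1 \<and> x $ k > 0")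
      case True
      then have le: "ennpow (ennreal (1 / e * \<bar>x $ k\<bar> powr (\<Sum>i<m. spike_exp i))) p
          * ennreal (joint_weight m P spike_weight x)
         \<le> ennpow (multi_maximal m spike x) p * ennreal (joint_weight m P spike_weight x)"
        using p_pos by (intro mult_right_mono ennpow_mono maximal_ge) auto
      have eq: "ennpow (ennreal (1 / e * \<bar>x $ k\<bar> powr (\<Sum>i<m. spike_exp i))) p
          * ennreal (joint_weight m P spike_weight x)
        = ennreal ((1 / e) powr p * (\<bar>x $ k\<bar> powr ((\<Sum>i<m. spike_exp i) * p)
            * \<bar>x $ k\<bar> powr ((1 - e) * (p / conj_exp (P i0)))))"
        unfolding joint_spike_weight using e p_pos
        by (subst ennpow_nonneg) (simp_all add: powr_mult powr_powr ennreal_mult[symmetric]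
            powr_divide)
      have pw: "\<bar>x $ k\<bar> powr ((\<Sum>i<m. spike_exp i) * p)
          * \<bar>x $ k\<bar> powr ((1 - e) * (p / conj_exp (P i0)))
          = \<bar>x $ k\<bar> powr (e - 1)"
        unfolding powr_add[symmetric] exponent ..
      from le[unfolded eq pw] show ?thesis
        using True by (simp add: ennreal_mult)
    next
      case False
      moreover have "0 \<le> x $ k" if "x \<in> cbox 0 1"
        using that by (simp add: mem_box_cart)
      ultimately have "x \<notin> cbox 0 1 \<or> x $ k = 0" by force
      then show ?thesis by auto
    qed
  qed
  finally have "ennpow (ennreal ((1 / e) powr p * (1 / e))) (1 / p)
      \<le> wnorm p (joint_weight m P spike_weight) (multi_maximal m spike)"
    unfolding wnorm_def using p_pos by (intro ennpow_mono) auto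
  moreover have "ennpow (ennreal ((1 / e) powr p * (1 / e))) (1 / p)
      = ennreal (1 / e * (1 / e) powr (1 / p))"
    using e p_pos by (simp add: ennpow_pos powr_mult powr_powr powr_divide)
  ultimately show ?thesis by simp
qed

end

lemma ennpow_le_of_one_le:
  assumes "1 \<le> x" "x \<le> ennreal y" "y \<ge> 1"
  shows "ennpow x \<alpha> \<le> ennreal (y powr max \<alpha> 0)"
proof (cases "\<alpha> \<ge> 0")
  case True
  have "ennpow x \<alpha> \<le> ennpow (ennreal y) \<alpha>" using assms True by (intro ennpow_mono)
  then show ?thesis using assms True by (simp add: ennpow_pos max_absorb1)
next
  case False
  from assms obtain z where z: "x = ennreal z" "z \<ge> 1"
    by (cases x) (auto simp: top_unique)
  have "z powr \<alpha> \<le> z powr 0" using z False by (intro powr_mono) auto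
  then show ?thesis using z assms False by (simp add: ennpow_pos max_absorb2)
qed

text \<open>For the example the inequality compares \<open>1 / e\<close> with the power \<open>\<delta> \<alpha>\<close> of \<open>2 / e\<close>, where
  \<open>\<delta> = p / p\<^bsub>i0\<^esub>'\<close> and hence \<open>\<delta> \<alpha> < 1\<close>, and fails for small \<open>e\<close>. Negative \<open>\<alpha>\<close> are no better than
  \<open>0\<close>, because weight constants are at least \<open>1\<close>.\<close>

lemma exponent_sharp:
  fixes \<alpha> C :: real
  assumes P: "\<And>i. i < m \<Longrightarrow> 1 < P i" and i0: "i0 < m" and \<alpha>: "\<alpha> < conj_exp (P i0) / joint_exp m P"
  shows "\<exists>w \<in> (AP m P :: (nat \<Rightarrow> real ^ 'n \<Rightarrow> real) set). \<exists>f. (\<forall>i<m. f i \<in> Lspace (P i) (w i)) \<and>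
     \<not> wnorm (joint_exp m P) (joint_weight m P w) (multi_maximal m f)
        \<le> ennreal C * ennpow (AP_const m P w) \<alpha> * (\<Prod>i<m. Lnorm (P i) (w i) (f i))"
proof -
  define k :: 'n where "k = undefined"
  define \<delta> where "\<delta> = joint_exp m P / conj_exp (P i0)"
  have p: "joint_exp m P > 0" using i0 P by (intro joint_exp_pos) auto
  have conj: "conj_exp (P i0) > 0" using P[OF i0] by (simp add: conj_exp_def)
  define \<gamma> where "\<gamma> = \<delta> * max \<alpha> 0"
  have \<gamma>: "\<gamma> < 1" "\<gamma> \<ge> 0" using \<alpha> p conj by (auto simp: \<gamma>_def \<delta>_def field_simps max_def)
  define B where "B = max C 0 * 2 powr \<gamma> + 1"
  have B: "B \<ge> 1" by (simp add: B_def)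
  \<comment> \<open>Chosen such that \<open>N\<close> to the power \<open>1 - \<gamma>\<close> exceeds the constant in the inequality.\<close>
  define N where "N = (B + 1) powr (1 / (1 - \<gamma>))"
  have N: "N > 1" unfolding N_def using B \<gamma> by (intro gr_one_powr) auto
  define e where "e = 1 / N"
  have e: "0 < e" "e < 1" using N by (auto simp: e_def)
  interpret power_weight_example m P i0 e k
    by standard (use P i0 e in auto)
  interpret MW: multiple_weight m P spike_weight
    by unfold_locales (use i0 P spike_weight_AP in auto)
  show ?thesis
  proof (intro bexI[OF _ spike_weight_AP] exI[of _ spike] conjI allI impI spike_Lspace notI)
    assume "wnorm p (joint_weight m P spike_weight) (multi_maximal m spike)
        \<le> ennreal C * ennpow (AP_const m P spike_weight) \<alpha>
            * (\<Prod>i<m. Lnorm (P i) (spike_weight i) (spike i))"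
    with wnorm_maximal_ge have "ennreal (1 / e * (1 / e) powr (1 / p))
       \<le> ennreal C * ennpow (AP_const m P spike_weight) \<alpha>
           * (\<Prod>i<m. Lnorm (P i) (spike_weight i) (spike i))"
      by (rule order_trans)
    also have "\<dots> \<le> ennreal (max C 0) * ennreal (((2 / e) powr \<delta>) powr max \<alpha> 0)
        * ennreal ((1 / e) powr (1 / p))"
    proof -
      have "1 \<le> (2 / e) powr \<delta>" using e p conj by (intro ge_one_powr_ge_zero) (auto simp: \<delta>_def)
      then have "ennpow (AP_const m P spike_weight) \<alpha> \<le> ennreal (((2 / e) powr \<delta>) powr max \<alpha> 0)"
        using AP_const_spike_weight_le MW.one_le_A unfolding \<delta>_def by (intro ennpow_le_of_one_le)
      then show ?thesis
        unfolding prod_Lnorm_spike by (intro mult_right_mono mult_mono) (auto intro: ennreal_leI)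
    qed
    also have "\<dots> = ennreal (max C 0 * (2 / e) powr \<gamma> * (1 / e) powr (1 / p))"
      by (simp add: ennreal_mult powr_powr \<gamma>_def)
    finally have "1 / e * (1 / e) powr (1 / p) \<le> max C 0 * (2 / e) powr \<gamma> * (1 / e) powr (1 / p)"
      using e by (subst (asm) ennreal_le_iff) auto
    then have "1 / e \<le> max C 0 * (2 / e) powr \<gamma>"
      by (rule mult_right_le_imp_le) (use e in simp)
    then have "N \<le> max C 0 * (2 * N) powr \<gamma>" by (simp add: e_def)
    also have "\<dots> = (max C 0 * 2 powr \<gamma>) * N powr \<gamma>" using N by (simp add: powr_mult)
    also have "\<dots> < (B + 1) * N powr \<gamma>" using N by (simp add: B_def)
    also have "B + 1 = N powr (1 - \<gamma>)" using B \<gamma> by (simp add: N_def powr_powr)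
    also have "N powr (1 - \<gamma>) * N powr \<gamma> = N" using N by (simp add: powr_add[symmetric])
    finally show False by simp
  qed
qed

section \<open>The sharp weighted bound\<close>

theorem theorem1p2:
  fixes m :: nat and P :: "nat \<Rightarrow> real" and p :: real
  assumes "m \<ge> 1" and "\<forall>i<m. 1 < P i" and "p = joint_exp m P"
  shows "(\<exists>C::real. \<forall>w \<in> (AP m P :: (nat \<Rightarrow> real ^ 'n \<Rightarrow> real) set).
            \<forall>f. (\<forall>i<m. f i \<in> Lspace (P i) (w i)) \<longrightarrow>
              wnorm p (joint_weight m P w) (multi_maximal m f)
                \<le> ennreal C * ennpow (AP_const m P w) (Max ((\<lambda>i. conj_exp (P i) / p) ` {..<m}))
                    * (\<Prod>i<m. Lnorm (P i) (w i) (f i)))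
       \<and> (\<forall>\<alpha> < Max ((\<lambda>i. conj_exp (P i) / p) ` {..<m}).
            \<not> (\<exists>C::real. \<forall>w \<in> (AP m P :: (nat \<Rightarrow> real ^ 'n \<Rightarrow> real) set).
              \<forall>f. (\<forall>i<m. f i \<in> Lspace (P i) (w i)) \<longrightarrow>
                wnorm p (joint_weight m P w) (multi_maximal m f)
                  \<le> ennreal C * ennpow (AP_const m P w) \<alpha>
                      * (\<Prod>i<m. Lnorm (P i) (w i) (f i))))"
proof (intro conjI allI impI notI)
  have P: "1 < P i" if "i < m" for i using assms(2) that by blast
  let ?E = "(\<lambda>i. conj_exp (P i) / p) ` {..<m}"
  have "conj_exp (P i) / joint_exp m P \<le> Max ?E" if "i < m" for i
    unfolding assms(3)[symmetric] using that by (intro Max_ge) auto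
  then show "\<exists>C::real. \<forall>w \<in> (AP m P :: (nat \<Rightarrow> real ^ 'n \<Rightarrow> real) set).
            \<forall>f. (\<forall>i<m. f i \<in> Lspace (P i) (w i)) \<longrightarrow>
              wnorm p (joint_weight m P w) (multi_maximal m f)
                \<le> ennreal C * ennpow (AP_const m P w) (Max ?E)
                    * (\<Prod>i<m. Lnorm (P i) (w i) (f i))"
    unfolding assms(3) using assms(1) P
    by (intro exI[of _ "maximal_const CARD('n) m P
        (Max ((\<lambda>i. conj_exp (P i) / joint_exp m P) ` {..<m}))"]
        ballI allI impI multiple_weight.multi_maximal_bound multiple_weight.intro)
      (auto simp: Lspace_def)
next
  fix \<alpha> assume \<alpha>: "\<alpha> < Max ((\<lambda>i. conj_exp (P i) / p) ` {..<m})"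
  assume "\<exists>C::real. \<forall>w \<in> (AP m P :: (nat \<Rightarrow> real ^ 'n \<Rightarrow> real) set).
              \<forall>f. (\<forall>i<m. f i \<in> Lspace (P i) (w i)) \<longrightarrow>
                wnorm p (joint_weight m P w) (multi_maximal m f)
                  \<le> ennreal C * ennpow (AP_const m P w) \<alpha>
                      * (\<Prod>i<m. Lnorm (P i) (w i) (f i))"
  then obtain C :: real where C: "\<forall>w \<in> (AP m P :: (nat \<Rightarrow> real ^ 'n \<Rightarrow> real) set).
              \<forall>f. (\<forall>i<m. f i \<in> Lspace (P i) (w i)) \<longrightarrow>
                wnorm p (joint_weight m P w) (multi_maximal m f)
                  \<le> ennreal C * ennpow (AP_const m P w) \<alpha>
                      * (\<Prod>i<m. Lnorm (P i) (w i) (f i))" ..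
  have "Max ((\<lambda>i. conj_exp (P i) / p) ` {..<m}) \<in> (\<lambda>i. conj_exp (P i) / p) ` {..<m}"
    using assms(1) by (intro Max_in) (auto simp: lessThan_empty_iff)
  then obtain i0 where "i0 < m" "\<alpha> < conj_exp (P i0) / joint_exp m P"
    using \<alpha> assms(3) by auto
  then show False
    using exponent_sharp[of m P i0 \<alpha> C] assms(2) C
    unfolding assms(3) by blast
qed

end
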